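(* Fix an integer $d \geq 3$ and a real number $\lambda < d$. For infinitely many positive integers $n$ (with $n\to\infty$), let $G=G_n$ be an $(n,d,\lambda)$ graph whose girth is at least $g=g(n)$, where $g(n)\to\infty$ as $n\to\infty$. Fix an integer $r\ge 1$ and a real $\mu>0$, and for each $n$ let $v_1,\ldots,v_r$ be vertices of $G$ whose pairwise distances are at least $g$. Let $\widetilde{W}=(w_0=v_1,w_1,\ldots,w_m)$ be a non-backtracking random walk of length $m=\lfloor\mu n\rfloor$ on $G$ starting from $v_1$, and let $X_i = |\{1\le j\le m : w_j = v_i\}|$ be the number of visits that $\widetilde{W}$ makes to $v_i$, for $i=1,\ldots,r$. Then $$(X_1,\ldots,X_r)\stackrel{d}{\to}(Z_1,\ldots,Z_r)\quad\text{as } n\to\infty,$$ where $\stackrel{d}{\to}$ denotes convergence in distribution and $Z_1,\ldots,Z_r$ are i.i.d. Poisson random variables with mean $\mu$.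
   Context: An $(n,d,\lambda)$ graph is a $d$-regular undirected graph on $n$ vertices such that, if $d=\lambda_1\ge\lambda_2\ge\dots\ge\lambda_n$ are the eigenvalues of its adjacency matrix, then $\max_{i>1}|\lambda_i| = \lambda$. The girth is the length of a shortest cycle; the distance between vertices is the graph distance, and "pairwise distances" refers to pairs $v_i,v_j$ with $i\ne j$. A non-backtracking random walk of length $k$ on $G$ starting from a vertex $w_0$ is a random sequence $(w_0,\ldots,w_k)$ of vertices, where $w_1$ is a uniformly chosen neighbor of $w_0$ and, for $i\ge 2$, given $w_0,\ldots,w_{i-1}$, the vertex $w_i$ is chosen uniformly among all neighbors of $w_{i-1}$ other than $w_{i-2}$. Visits are counted at times $1,\ldots,m$ only (the starting position at time $0$ is not counted). *)

theory Defs
  imports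
    "HOL-Probability.Probability"
    "Jordan_Normal_Form.Char_Poly"
    "Graph_Theory.Graph_Theory"
begin

text \<open>
  A finite simple undirected graph is a \<open>pair_graph\<close>: a finite, loop-free, symmetric digraph
  whose arcs are ordered pairs of vertices.
\<close>

definition neighbours :: "'v pair_pre_digraph \<Rightarrow> 'v \<Rightarrow> 'v set" where
  "neighbours G u = {w. (u, w) \<in> parcs G}"

definition regular_graph :: "nat \<Rightarrow> 'v pair_pre_digraph \<Rightarrow> bool" where
  "regular_graph d G \<longleftrightarrow> (\<forall>u\<in>pverts G. card (neighbours G u) = d)"

definition adj_matrix :: "'v pair_pre_digraph \<Rightarrow> 'v list \<Rightarrow> real mat" where
  "adj_matrix G vs =
     mat (length vs) (length vs) (\<lambda>(i, j). if (vs ! i, vs ! j) \<in> parcs G then 1 else 0)"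

text \<open>
  \<open>adj_eigenvalues G ls\<close>: \<open>ls\<close> lists the eigenvalues of the adjacency matrix with multiplicity in
  non-increasing order. Enumerating the vertices differently conjugates the matrix by a
  permutation, so the choice of \<open>vs\<close> is immaterial.
\<close>

definition adj_eigenvalues :: "'v pair_pre_digraph \<Rightarrow> real list \<Rightarrow> bool" where
  "adj_eigenvalues G ls \<longleftrightarrow> sorted_wrt (\<ge>) ls \<and>
     (\<exists>vs. distinct vs \<and> set vs = pverts G \<and>
           char_poly (adj_matrix G vs) = (\<Prod>a\<leftarrow>ls. [:- a, 1:]))"

text \<open>List indices start at 0, so \<open>ls ! 0\<close> is the largest eigenvalue.\<close>

definition ndl_graph :: "nat \<Rightarrow> nat \<Rightarrow> real \<Rightarrow> 'v pair_pre_digraph \<Rightarrow> bool" where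
  "ndl_graph n d lam G \<longleftrightarrow>
     pair_graph G \<and> card (pverts G) = n \<and> regular_graph d G \<and>
     (\<exists>ls. adj_eigenvalues G ls \<and> ls ! 0 = real d \<and>
           Max {\<bar>ls ! i\<bar> | i. 1 \<le> i \<and> i < n} = lam)"

text \<open>
  A symmetric digraph has the closed walks \<open>u, w, u\<close> as \<open>cycles\<close> of length 2, which are not cycles
  of the undirected graph; hence the restriction to length at least 3. The girth of a forest
  is \<open>\<infinity>\<close>.
\<close>

definition girth :: "'v pair_pre_digraph \<Rightarrow> ereal" where
  "girth G = (INF p \<in> {p. pre_digraph.cycle (with_proj G) p \<and> 3 \<le> length p}. ereal (real (length p)))"

text \<open>Shortest-path distance with unit arc weights; \<open>\<infinity>\<close> between different components.\<close>

definition graph_dist :: "'v pair_pre_digraph \<Rightarrow> 'v \<Rightarrow> 'v \<Rightarrow> ereal" where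
  "graph_dist G u w = wf_digraph.\<mu> (with_proj G) (\<lambda>_. 1) u w"

definition nb_next :: "'v pair_pre_digraph \<Rightarrow> 'v list \<Rightarrow> 'v set" where
  "nb_next G ws =
     (if length ws < 2 then neighbours G (last ws)
      else neighbours G (last ws) - {ws ! (length ws - 2)})"

text \<open>
  The law of the trajectory \<open>[w\<^sub>0, \<dots>, w\<^sub>k]\<close> of the non-backtracking random walk of length \<open>k\<close> started
  at \<open>u\<close>. Note that \<open>pmf_of_set\<close> is meaningful only for finite nonempty sets, which is the case for
  \<open>nb_next\<close> in a finite graph of minimum degree at least 2.
\<close>

primrec nb_walk :: "'v pair_pre_digraph \<Rightarrow> 'v \<Rightarrow> nat \<Rightarrow> 'v list pmf" where
  "nb_walk G u 0 = return_pmf [u]"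
| "nb_walk G u (Suc k) =
     bind_pmf (nb_walk G u k) (\<lambda>ws. map_pmf (\<lambda>w. ws @ [w]) (pmf_of_set (nb_next G ws)))"

definition visits :: "nat \<Rightarrow> 'v list \<Rightarrow> 'v \<Rightarrow> nat" where
  "visits m ws u = card {j. 1 \<le> j \<and> j \<le> m \<and> ws ! j = u}"

text \<open>
  Convergence in distribution along the filter \<open>F\<close> of random variables \<open>X n\<close> on \<open>M n\<close> to \<open>Z\<close> on
  \<open>M'\<close>, i.e. weak convergence of their laws, tested on bounded continuous functions.
  (\<open>weak_conv_m\<close> covers only real-valued variables.)
\<close>

definition converges_in_distribution ::
  "'i filter \<Rightarrow> ('i \<Rightarrow> 'a measure) \<Rightarrow> ('i \<Rightarrow> 'a \<Rightarrow> 'c::topological_space) \<Rightarrow>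
   'b measure \<Rightarrow> ('b \<Rightarrow> 'c) \<Rightarrow> bool" where
  "converges_in_distribution F M X M' Z \<longleftrightarrow>
     (\<forall>f :: 'c \<Rightarrow> real. continuous_on UNIV f \<and> bounded (range f) \<longrightarrow>
        ((\<lambda>n. integral\<^sup>L (distr (M n) borel (X n)) f) \<longlongrightarrow> integral\<^sup>L (distr M' borel Z) f) F)"

end

theory Submission
  imports Defs "Jordan_Normal_Form.Schur_Decomposition"
begin

text \<open>
  The vector of visit counts is compared with a Poisson vector through a renewal-type equation.
  Charging every visit with the change it causes in the event ``the remaining counts equal \<open>x\<close>''
  gives \<open>P\<^sub>e(X(m) = x) = [x = 0] + \<Sum>\<^sub>s \<Sum>\<^sub>i E[1(w\<^sub>s = v\<^sub>i) (P(X(m - s) = x - e\<^sub>i) - P(X(m - s) = x))]\<close>,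
  the inner probabilities being those of the walk continued from time \<open>s\<close>. The product Poisson
  weights with mean \<open>m / n\<close> satisfy the same equation with \<open>P(w\<^sub>s = v\<^sub>i)\<close> replaced by \<open>1 / n\<close>, up to
  a discretisation error \<open>O(1 / n)\<close>. A Gronwall argument then reduces the theorem to showing that
  \<open>\<Sum>\<^sub>s \<bar>P(w\<^sub>s = v\<^sub>i) - 1 / n\<bar>\<close> is small for every start at some \<open>v\<^sub>j\<close> with a prescribed previous
  vertex. For \<open>s\<close> below the girth bound the probability is 0. For large \<open>s\<close> it is within \<open>C \<rho>\<^sup>s\<close> of
  \<open>1 / n\<close>, since the transition matrices are polynomials in the adjacency matrix that decay
  geometrically, uniformly on \<open>[-\<lambda>, \<lambda>]\<close> when \<open>\<lambda> < d\<close>.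
\<close>

section \<open>Product Poisson weights\<close>

text \<open>The walk remembers its previous vertex, so what follows a visit to
  \<open>v\<^sub>i\<close> depends on how the visit was reached. The comparison is therefore made
  for every admissible history that ends at some \<open>v\<^sub>i\<close>, and it closes on itself
  because the renewal equation restarts the walk only from such histories. From them girth and
  distances exclude a hit in the next few steps.

  About \<mu> n deviations are added, so a bound of order 1 / n for each would not be enough.
  Cutting at a fixed time L leaves L terms equal to 1 / n and a tail of order \<rho>^L; n tends to
  infinity before L does.

  The rate comes from the roots of z^2 - (x / (d - 1)) z + 1 / (d - 1), which govern the recursion
  of the transition polynomials at an eigenvalue x. At x = d they are 1 and 1 / (d - 1); for |x|
  \<le> \<lambda> < d both stay inside a fixed disc of radius less than 1.\<close>

definition pois :: "real \<Rightarrow> int \<Rightarrow> real" where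
  "pois t k = (if k < 0 then 0 else exp (- t) * t ^ nat k / fact (nat k))"

lemma pois_bounds:
  assumes "0 \<le> t"
  shows "0 \<le> pois t k" "pois t k \<le> 1"
proof -
  show "0 \<le> pois t k" using assms by (simp add: pois_def)
  show "pois t k \<le> 1"
    using pmf_le_1[of "poisson_pmf t" "nat k"] assms by (cases "t = 0") (auto simp: pois_def mult_ac power_0_left)
qed

text \<open>Forward equation of the Poisson process of rate 1. Since \<open>pois\<close> vanishes on
  negative integers, it also holds at k = 0 and below without a boundary term.\<close>

lemma pois_deriv: "((\<lambda>t. pois t k) has_real_derivative pois t (k - 1) - pois t k) (at t)"
proof -
  consider "k < 0" | "k = 0" | j where "k = 1 + int j"
    by (metis zero_less_iff_neq_zero zless_iff_Suc_zadd add.commute int_one_le_iff_zero_less le_add_diff_inverse linorder_neqE_linordered_idom nonneg_int_cases zle_iff_zadd)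
  then show ?thesis
  proof cases
    case 1
    then show ?thesis by (simp add: pois_def)
  next
    case 2
    then show ?thesis by (auto simp: pois_def intro!: derivative_eq_intros)
  next
    case 3
    have *: "nat (1 + int j) = Suc j" by simp
    have pow: "((\<lambda>t::real. t ^ Suc j) has_real_derivative real (Suc j) * t ^ j) (at t)"
      using DERIV_pow[of "Suc j" t UNIV] by simp
    have "((\<lambda>t. exp (- t) * t ^ Suc j / fact (Suc j)) has_real_derivative
      (exp (- t) * - 1 * t ^ Suc j + real (Suc j) * t ^ j * exp (- t)) / fact (Suc j)) (at t)"
      by (intro DERIV_cdivide DERIV_mult pow DERIV_chain2[OF DERIV_exp] DERIV_minus DERIV_ident)
    moreover have "(exp (- t) * - 1 * t ^ Suc j + real (Suc j) * t ^ j * exp (- t)) / fact (Suc j) =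
      exp (- t) * t ^ j / fact j - exp (- t) * t ^ Suc j / fact (Suc j)"
      unfolding fact_Suc of_nat_mult by (simp add: divide_simps del: of_nat_Suc power_Suc)
    ultimately show ?thesis
      unfolding 3 pois_def * by simp
  qed
qed

definition mpois :: "real \<Rightarrow> ('r::finite \<Rightarrow> int) \<Rightarrow> real" where
  "mpois t x = (\<Prod>i\<in>UNIV. pois t (x i))"

text \<open>Right-hand side of the forward equation for independent rate 1 Poisson processes, one
  per coordinate. Its summands have the same shape as those of \<open>hit_jump\<close>.\<close>

definition mpois_diff :: "real \<Rightarrow> ('r::finite \<Rightarrow> int) \<Rightarrow> real" where
  "mpois_diff t x = (\<Sum>i\<in>UNIV. mpois t (x(i := x i - 1)) - mpois t x)"

lemma mpois_bounds:
  assumes "0 \<le> t"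
  shows "0 \<le> mpois t x" "mpois t x \<le> 1"
  using pois_bounds[OF assms] by (auto simp: mpois_def intro!: prod_nonneg prod_le_1)

lemma mpois_0: "mpois 0 x = of_bool (x = (\<lambda>_. 0))"
proof (cases "x = (\<lambda>_. 0)")
  case True
  then show ?thesis by (simp add: mpois_def pois_def)
next
  case False
  then obtain i where "x i \<noteq> 0" by auto
  then have "pois 0 (x i) = 0" by (auto simp: pois_def power_0_left)
  then show ?thesis using False by (auto simp: mpois_def)
qed

lemma mpois_deriv: "((\<lambda>t. mpois t x) has_real_derivative mpois_diff t x) (at t)"
proof -
  have "((\<lambda>t. mpois t x) has_real_derivative
      (\<Sum>i\<in>UNIV. (pois t (x i - 1) - pois t (x i)) * (\<Prod>j\<in>UNIV - {i}. pois t (x j)))) (at t)"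
    unfolding mpois_def by (rule has_field_derivative_prod) (rule pois_deriv)
  moreover have "mpois t (x(i := x i - 1)) - mpois t x =
      (pois t (x i - 1) - pois t (x i)) * (\<Prod>j\<in>UNIV - {i}. pois t (x j))" for i
    unfolding mpois_def
    by (subst (1 2) prod.remove[of UNIV i]) (auto simp: algebra_simps intro!: prod.cong)
  ultimately show ?thesis by (simp add: mpois_diff_def)
qed

lemma abs_diff_le_unit:
  fixes a b :: real
  assumes "0 \<le> a" "a \<le> 1" "0 \<le> b" "b \<le> 1"
  shows "\<bar>a - b\<bar> \<le> 1"
  using assms by linarith

lemma mpois_diff_bound:
  fixes x :: "'r::finite \<Rightarrow> int"
  assumes "0 \<le> t"
  shows "\<bar>mpois_diff t x\<bar> \<le> CARD('r)"
proof -
  have "\<bar>mpois_diff t x\<bar> \<le> (\<Sum>i\<in>(UNIV::'r set). 1)"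
    unfolding mpois_diff_def
    by (rule sum_abs[THEN order_trans], rule sum_mono)
      (intro abs_diff_le_unit mpois_bounds assms)
  then show ?thesis by simp
qed

lemma mpois_lipschitz:
  fixes x :: "'r::finite \<Rightarrow> int"
  assumes "0 \<le> s" "s \<le> t"
  shows "\<bar>mpois t x - mpois s x\<bar> \<le> real CARD('r) * (t - s)"
proof (cases "s = t")
  case False
  with assms have "s < t" by simp
  obtain z where "s < z" "z < t" "mpois t x - mpois s x = (t - s) * mpois_diff z x"
    using MVT2[of s t "\<lambda>t. mpois t x" "\<lambda>t. mpois_diff t x"] mpois_deriv \<open>s < t\<close> by blast
  then show ?thesis using mpois_diff_bound[of z x] assms
    by (simp add: abs_mult mult.commute mult_left_mono)
qed simp

text \<open>The constant counts \<open>CARD('r)\<close> summands with two values of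
  \<open>mpois\<close> each, every one of them Lipschitz with constant
  \<open>CARD('r)\<close>.\<close>

lemma mpois_diff_lipschitz:
  fixes x :: "'r::finite \<Rightarrow> int"
  assumes "0 \<le> s" "s \<le> t"
  shows "\<bar>mpois_diff t x - mpois_diff s x\<bar> \<le> 2 * (real CARD('r))\<^sup>2 * (t - s)"
proof -
  have "mpois_diff t x - mpois_diff s x = (\<Sum>i\<in>UNIV.
     (mpois t (x(i := x i - 1)) - mpois s (x(i := x i - 1))) - (mpois t x - mpois s x))"
    by (simp add: mpois_diff_def sum_subtractf[symmetric] algebra_simps del: sum_subtractf)
  also have "\<bar>\<dots>\<bar> \<le> (\<Sum>i\<in>(UNIV::'r set). 2 * real CARD('r) * (t - s))"
    apply (rule sum_abs[THEN order_trans], rule sum_mono)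
    subgoal for i
      using mpois_lipschitz[OF assms, of x] mpois_lipschitz[OF assms, of "x(i := x i - 1)"]
      by (simp add: abs_le_iff)
    done
  finally show ?thesis by (simp add: power2_eq_square mult_ac)
qed

lemma mpois_euler_step:
  fixes x :: "'r::finite \<Rightarrow> int"
  assumes "0 \<le> t" "0 < h"
  shows "\<bar>mpois (t + h) x - mpois t x - h * mpois_diff t x\<bar> \<le> 2 * (real CARD('r))\<^sup>2 * h\<^sup>2"
proof -
  obtain z where z: "t < z" "z < t + h" "mpois (t + h) x - mpois t x = (t + h - t) * mpois_diff z x"
    using MVT2[of t "t + h" "\<lambda>t. mpois t x" "\<lambda>t. mpois_diff t x"] mpois_deriv assms by auto
  have "\<bar>mpois_diff z x - mpois_diff t x\<bar> \<le> 2 * (real CARD('r))\<^sup>2 * (z - t)"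
    using z assms by (intro mpois_diff_lipschitz) auto
  also have "\<dots> \<le> 2 * (real CARD('r))\<^sup>2 * h"
    using z by (intro mult_left_mono) auto
  finally have "h * \<bar>mpois_diff z x - mpois_diff t x\<bar> \<le> h * (2 * (real CARD('r))\<^sup>2 * h)"
    using assms by (intro mult_left_mono) auto
  moreover have "mpois (t + h) x - mpois t x - h * mpois_diff t x = h * (mpois_diff z x - mpois_diff t x)"
    using z by (simp add: algebra_simps)
  ultimately show ?thesis using assms by (simp add: abs_mult power2_eq_square mult_ac)
qed

text \<open>The forward equation integrated by left Riemann sums of mesh h: the local errors of
  \<open>mpois_euler_step\<close> add up over m steps. With h = 1 / n and m at most \<mu> n the
  total is of order 1 / n.\<close>

lemma mpois_euler:
  fixes x :: "'r::finite \<Rightarrow> int"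
  assumes "0 < h"
  shows "\<bar>mpois (real m * h) x - of_bool (x = (\<lambda>_. 0)) - h * (\<Sum>j<m. mpois_diff (real j * h) x)\<bar>
    \<le> real m * (2 * (real CARD('r))\<^sup>2 * h\<^sup>2)"
proof (induction m)
  case 0
  then show ?case by (simp add: mpois_0)
next
  case (Suc m)
  have "\<bar>mpois (real m * h + h) x - mpois (real m * h) x - h * mpois_diff (real m * h) x\<bar> \<le> 2 * (real CARD('r))\<^sup>2 * h\<^sup>2"
    using assms by (intro mpois_euler_step) auto
  with Suc.IH show ?case
    by (simp add: algebra_simps abs_le_iff)
qed

section \<open>Hitting counts of a Markov chain\<close>

primrec kiter :: "('s \<Rightarrow> 's pmf) \<Rightarrow> nat \<Rightarrow> 's \<Rightarrow> 's pmf" where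
  "kiter K 0 e = return_pmf e"
| "kiter K (Suc m) e = bind_pmf (K e) (kiter K m)"

text \<open>A visit is charged to the state being entered, so the start is not counted. Counts are
  integers so that one can be lowered at 0, where this law and \<open>pois\<close> both give
  probability 0.\<close>

primrec hit_law :: "('s \<Rightarrow> 's pmf) \<Rightarrow> ('r \<Rightarrow> 's set) \<Rightarrow> nat \<Rightarrow> 's \<Rightarrow> ('r \<Rightarrow> int) pmf" where
  "hit_law K H 0 e = return_pmf (\<lambda>_. 0)"
| "hit_law K H (Suc m) e =
     bind_pmf (K e) (\<lambda>f. map_pmf (\<lambda>y i. y i + of_bool (f \<in> H i)) (hit_law K H m f))"

lemma kiter_Suc_right: "kiter K (Suc m) e = bind_pmf (kiter K m e) K"
proof (induction m arbitrary: e)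
  case 0
  have "kiter K 0 = return_pmf" by (rule ext) simp
  then show ?case by (simp add: bind_return_pmf bind_return_pmf')
next
  case (Suc m)
  have "kiter K (Suc m) = (\<lambda>e. bind_pmf (kiter K m e) K)" by (rule ext) (rule Suc.IH)
  then have "kiter K (Suc (Suc m)) e = bind_pmf (K e) (\<lambda>e. bind_pmf (kiter K m e) K)"
    by (simp only: kiter.simps(2)[of K "Suc m"])
  then show ?case by (simp only: bind_assoc_pmf kiter.simps(2)[of K m])
qed

lemma set_kiter:
  assumes "\<And>e. e \<in> V \<Longrightarrow> set_pmf (K e) \<subseteq> V" "e \<in> V"
  shows "set_pmf (kiter K m e) \<subseteq> V"
  using assms(2)
proof (induction m arbitrary: e)
  case (Suc m)
  then show ?case using assms(1)[OF Suc.prems] by (simp add: UN_subset_iff) blast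
qed simp

lemma pmf_integrable_bounded:
  fixes f :: "'a \<Rightarrow> real"
  assumes "\<And>x. \<bar>f x\<bar> \<le> B"
  shows "integrable (measure_pmf M) f"
  by (rule measure_pmf.integrable_const_bound[where B = B]) (use assms in auto)

lemma expectation_bind_bounded:
  fixes f :: "'a \<Rightarrow> real"
  assumes "\<And>x. \<bar>f x\<bar> \<le> B"
  shows "measure_pmf.expectation (bind_pmf M k) f =
    measure_pmf.expectation M (\<lambda>x. measure_pmf.expectation (k x) f)"
  unfolding measure_pmf_bind
  by (rule integral_bind[where K = "count_space UNIV" and B = B and B' = 1])
    (use assms in \<open>auto simp: measure_pmf.emeasure_space_1
       intro!: measure_pmf_in_subprob_algebra\<close>)

lemma abs_expectation_le:
  fixes f :: "'a \<Rightarrow> real"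
  assumes "\<And>x. \<bar>f x\<bar> \<le> B"
  shows "\<bar>measure_pmf.expectation M f\<bar> \<le> B"
proof -
  have "\<bar>measure_pmf.expectation M f\<bar> \<le> measure_pmf.expectation M (\<lambda>x. \<bar>f x\<bar>)"
    by (rule integral_abs_bound)
  also have "\<dots> \<le> B"
    by (rule measure_pmf.integral_le_const, rule pmf_integrable_bounded[where B = B])
      (use assms in auto)
  finally show ?thesis .
qed

lemma pmf_hit_law_Suc:
  "pmf (hit_law K H (Suc m) e) x =
    measure_pmf.expectation (K e) (\<lambda>f. pmf (hit_law K H m f) (\<lambda>i. x i - of_bool (f \<in> H i)))"
proof -
  have "pmf (map_pmf (\<lambda>y i. y i + of_bool (f \<in> H i)) (hit_law K H m f)) x =
      pmf (hit_law K H m f) (\<lambda>i. x i - of_bool (f \<in> H i))" (is "pmf (map_pmf ?g _) _ = _") for f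
  proof -
    have "inj ?g" by (auto simp: inj_def fun_eq_iff)
    from pmf_map_inj'[OF this, of _ "\<lambda>i. x i - of_bool (f \<in> H i)"] show ?thesis by simp
  qed
  then show ?thesis by (simp add: pmf_bind)
qed

text \<open>If the current state f lies in \<open>H i\<close>, one visit is used up and the
  remaining m steps must produce x with coordinate i lowered by one, instead of x. This is the
  resulting change of probability.\<close>

definition hit_jump ::
  "('s \<Rightarrow> 's pmf) \<Rightarrow> ('r::finite \<Rightarrow> 's set) \<Rightarrow> nat \<Rightarrow> ('r \<Rightarrow> int) \<Rightarrow> 's \<Rightarrow> real" where
  "hit_jump K H m x f = (\<Sum>i\<in>UNIV. of_bool (f \<in> H i) *
     (pmf (hit_law K H m f) (x(i := x i - 1)) - pmf (hit_law K H m f) x))"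

lemma abs_pmf_diff: "\<bar>pmf M x - pmf M y\<bar> \<le> 1"
  using pmf_nonneg[of M x] pmf_nonneg[of M y] pmf_le_1[of M x] pmf_le_1[of M y] by linarith

lemma hit_jump_bound: "\<bar>hit_jump K H m (x :: 'r::finite \<Rightarrow> int) f\<bar> \<le> CARD('r)"
proof -
  have "\<bar>hit_jump K H m x f\<bar> \<le> (\<Sum>i\<in>(UNIV::'r set). 1)"
    unfolding hit_jump_def
    by (rule sum_abs[THEN order_trans], rule sum_mono) (auto simp: abs_mult abs_pmf_diff)
  then show ?thesis by simp
qed

text \<open>By disjointness f lies in at most one \<open>H i\<close>, so the shift lowers at most
  one coordinate and at most one summand of \<open>hit_jump\<close> survives.\<close>

lemma pmf_hit_law_shift:
  assumes "\<And>i j. i \<noteq> j \<Longrightarrow> H i \<inter> H j = {}"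
  shows "pmf (hit_law K H m f) (\<lambda>i. x i - of_bool (f \<in> H i)) =
    pmf (hit_law K H m f) x + hit_jump K H m x f"
proof (cases "\<exists>i. f \<in> H i")
  case True
  then obtain i where i: "f \<in> H i" by auto
  have iff: "f \<in> H j \<longleftrightarrow> j = i" for j using assms[of i j] i by auto
  then have "(\<lambda>i. x i - of_bool (f \<in> H i)) = x(i := x i - 1)" by (auto simp: fun_eq_iff)
  moreover have "hit_jump K H m x f = (\<Sum>j\<in>{i}. of_bool (f \<in> H j) *
      (pmf (hit_law K H m f) (x(j := x j - 1)) - pmf (hit_law K H m f) x))"
    unfolding hit_jump_def by (rule sum.mono_neutral_right) (auto simp: iff)
  ultimately show ?thesis using i by simp
next
  case False
  then show ?thesis by (simp add: hit_jump_def)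
qed

text \<open>Conditioning on the first step splits off the jump at time 1. The unshifted remainder is
  the same quantity with one step less, and its jump at time s becomes the jump at time s +
  1.\<close>

lemma pmf_hit_law_expand:
  assumes "\<And>i j. i \<noteq> j \<Longrightarrow> H i \<inter> H j = {}"
  shows "pmf (hit_law K H m e) x = of_bool (x = (\<lambda>_. 0)) +
    (\<Sum>s<m. measure_pmf.expectation (kiter K (Suc s) e) (hit_jump K H (m - Suc s) x))"
proof (induction m arbitrary: e)
  case 0
  show ?case by (auto simp: pmf_return indicator_def)
next
  case (Suc m)
  let ?J = "\<lambda>s. hit_jump K H (m - s) x"
  have int_J: "integrable (measure_pmf M) (\<lambda>f. hit_jump K H j x f)" for M j
    using hit_jump_bound[of K H] by (rule pmf_integrable_bounded)
  have int_E: "integrable (measure_pmf M) (\<lambda>f. measure_pmf.expectation (k f) (hit_jump K H j x))" for M j k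
    by (rule pmf_integrable_bounded, rule abs_expectation_le, rule hit_jump_bound)
  have "pmf (hit_law K H (Suc m) e) x =
      measure_pmf.expectation (K e) (\<lambda>f. pmf (hit_law K H m f) x + hit_jump K H m x f)"
    by (subst pmf_hit_law_Suc, subst pmf_hit_law_shift[where H = H]) (use assms in auto)
  also have "\<dots> = measure_pmf.expectation (K e) (\<lambda>f. pmf (hit_law K H m f) x) +
      measure_pmf.expectation (K e) (hit_jump K H m x)"
    by (rule Bochner_Integration.integral_add[OF _ int_J])
      (rule pmf_integrable_bounded[where B = 1], simp add: pmf_le_1)
  also have "measure_pmf.expectation (K e) (\<lambda>f. pmf (hit_law K H m f) x) = of_bool (x = (\<lambda>_. 0)) +
      (\<Sum>s<m. measure_pmf.expectation (K e)
        (\<lambda>f. measure_pmf.expectation (kiter K (Suc s) f) (?J (Suc s))))"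
    unfolding Suc.IH
    by (subst Bochner_Integration.integral_add) (auto simp: int_E simp del: kiter.simps)
  also have "(\<Sum>s<m. measure_pmf.expectation (K e)
        (\<lambda>f. measure_pmf.expectation (kiter K (Suc s) f) (?J (Suc s)))) =
      (\<Sum>s<m. measure_pmf.expectation (kiter K (Suc (Suc s)) e) (?J (Suc s)))"
    by (subst (2) kiter.simps(2), subst expectation_bind_bounded[OF hit_jump_bound]) simp
  also have "of_bool (x = (\<lambda>_. 0)) + \<dots> + measure_pmf.expectation (K e) (hit_jump K H m x) =
      of_bool (x = (\<lambda>_. 0)) +
      (\<Sum>s<Suc m. measure_pmf.expectation (kiter K (Suc s) e) (hit_jump K H (Suc m - Suc s) x))"
  proof -
    have "kiter K (Suc 0) e = K e"
      by (simp only: kiter_Suc_right) (simp add: bind_return_pmf)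
    then show ?thesis by (simp add: sum.lessThan_Suc_shift del: kiter.simps sum.lessThan_Suc)
  qed
  finally show ?case .
qed

lemma expectation_indicator_approx:
  fixes A :: "'s \<Rightarrow> real"
  assumes "0 \<le> h" "0 \<le> \<delta>" "\<bar>a\<bar> \<le> 1" "\<And>f. \<bar>A f\<bar> \<le> 1"
    and "\<And>f. f \<in> set_pmf M \<Longrightarrow> f \<in> S \<Longrightarrow> \<bar>A f - a\<bar> \<le> \<delta>"
  shows "\<bar>measure_pmf.expectation M (\<lambda>f. of_bool (f \<in> S) * A f) - h * a\<bar>
    \<le> h * \<delta> + 3 * \<bar>measure_pmf.prob M S - h\<bar>"
proof -
  \<comment> \<open>The cap 2 bounds every |A f - a|, so replacing \<open>?p\<close> by h costs at
    most 2 |?p - h| however large \<delta> is. Passing from \<open>?p * a\<close> to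
    \<open>h * a\<close> adds the third copy.\<close>
  let ?p = "measure_pmf.prob M S" and ?c = "min \<delta> 2"
  have ind: "(\<lambda>f. of_bool (f \<in> S)) = (indicator S :: 's \<Rightarrow> real)" by (auto simp: indicator_def)
  have i1: "integrable (measure_pmf M) (\<lambda>f. of_bool (f \<in> S) * A f)"
    by (rule pmf_integrable_bounded[where B = 1]) (use assms(4) in auto)
  have i2: "integrable (measure_pmf M) (\<lambda>f. of_bool (f \<in> S) * c)" for c :: real
    by (rule pmf_integrable_bounded[where B = "\<bar>c\<bar>"]) auto
  have E2: "measure_pmf.expectation M (\<lambda>f. of_bool (f \<in> S) * c) = ?p * c" for c
    using ind by (simp add: fun_eq_iff)
  have "\<bar>measure_pmf.expectation M (\<lambda>f. of_bool (f \<in> S) * A f) - ?p * a\<bar> =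
      \<bar>measure_pmf.expectation M (\<lambda>f. of_bool (f \<in> S) * A f - of_bool (f \<in> S) * a)\<bar>"
    by (subst Bochner_Integration.integral_diff[OF i1 i2]) (simp only: E2)
  also have "\<dots> \<le> measure_pmf.expectation M (\<lambda>f. \<bar>of_bool (f \<in> S) * A f - of_bool (f \<in> S) * a\<bar>)"
    by (rule integral_abs_bound)
  also have "\<dots> \<le> measure_pmf.expectation M (\<lambda>f. of_bool (f \<in> S) * ?c)"
  proof (rule integral_mono_AE[OF _ i2])
    show "integrable (measure_pmf M) (\<lambda>f. \<bar>of_bool (f \<in> S) * A f - of_bool (f \<in> S) * a\<bar>)"
      using i1 i2 by auto
    have "\<bar>A f - a\<bar> \<le> 2" for f using assms(3) assms(4)[of f] by linarith
    then show "AE f in measure_pmf M. \<bar>of_bool (f \<in> S) * A f - of_bool (f \<in> S) * a\<bar> \<le> of_bool (f \<in> S) * ?c"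
      using assms(5) by (auto simp: AE_measure_pmf_iff)
  qed
  also have "\<dots> = ?p * ?c" by (rule E2)
  also have "\<dots> = h * ?c + (?p - h) * ?c" by (simp add: algebra_simps)
  also have "\<dots> \<le> h * \<delta> + \<bar>?p - h\<bar> * 2"
    by (intro add_mono mult_left_mono mult_mono) (use assms in auto)
  finally have "\<bar>measure_pmf.expectation M (\<lambda>f. of_bool (f \<in> S) * A f) - ?p * a\<bar> \<le> h * \<delta> + 2 * \<bar>?p - h\<bar>"
    by simp
  moreover have "\<bar>?p * a - h * a\<bar> \<le> \<bar>?p - h\<bar> * 1"
    unfolding left_diff_distrib[symmetric] abs_mult by (intro mult_left_mono assms) auto
  ultimately show ?thesis by linarith
qed

text \<open>A discrete Gronwall argument: both sides satisfy the same Volterra equation up to an error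
  of \<open>3 r \<eta>\<close> from the hitting probabilities and an Euler discretisation error.\<close>

lemma hit_law_poisson:
  fixes H :: "'r::finite \<Rightarrow> 's set"
  assumes disj: "\<And>i j. i \<noteq> j \<Longrightarrow> H i \<inter> H j = {}"
    and closed: "\<And>e. e \<in> V \<Longrightarrow> set_pmf (K e) \<subseteq> V"
    and h: "0 < h" and \<eta>: "0 \<le> \<eta>"
    and mix: "\<And>e i. e \<in> V \<Longrightarrow> e \<in> (\<Union>i. H i) \<Longrightarrow>
      (\<Sum>s<m0. \<bar>measure_pmf.prob (kiter K (Suc s) e) (H i) - h\<bar>) \<le> \<eta>"
    and "m \<le> m0" "e \<in> V" "e \<in> (\<Union>i. H i)"
  shows "\<bar>pmf (hit_law K H m e) x - mpois (real m * h) x\<bar> \<le>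
    (3 * real CARD('r) * \<eta> + real m0 * (2 * (real CARD('r))\<^sup>2 * h\<^sup>2)) * (1 + 2 * real CARD('r) * h) ^ m"
proof -
  \<comment> \<open>\<open>\<epsilon>\<close> is the defect of the equation itself.
    \<open>q - 1\<close> is the feedback per time step: \<open>CARD('r)\<close> targets, each
    entering with weight h and two probabilities.\<close>
  define q \<epsilon> where "q = 1 + 2 * real CARD('r) * h"
    and "\<epsilon> = 3 * real CARD('r) * \<eta> + real m0 * (2 * (real CARD('r))\<^sup>2 * h\<^sup>2)"
  have \<epsilon>: "0 \<le> \<epsilon>" and q: "0 \<le> q" using \<eta> h by (auto simp: \<epsilon>_def q_def)
  have "\<bar>pmf (hit_law K H m e) x - mpois (real m * h) x\<bar> \<le> \<epsilon> * q ^ m"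
    using assms(6-8)
  proof (induction m arbitrary: e x rule: less_induct)
    case (less m)
    let ?r = "real CARD('r)"
    let ?P = "\<lambda>s i. measure_pmf.prob (kiter K (Suc s) e) (H i)"
    let ?A = "\<lambda>s i f. pmf (hit_law K H (m - Suc s) f) (x(i := x i - 1)) - pmf (hit_law K H (m - Suc s) f) x"
    let ?a = "\<lambda>s i. mpois (real (m - Suc s) * h) (x(i := x i - 1)) - mpois (real (m - Suc s) * h) x"
    have term_le: "\<bar>measure_pmf.expectation (kiter K (Suc s) e) (\<lambda>f. of_bool (f \<in> H i) * ?A s i f) - h * ?a s i\<bar>
        \<le> h * (2 * \<epsilon> * q ^ (m - Suc s)) + 3 * \<bar>?P s i - h\<bar>" if "s < m" for s i
    proof (rule expectation_indicator_approx)
      show "0 \<le> h" using h by simp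
      show "0 \<le> 2 * \<epsilon> * q ^ (m - Suc s)" using \<epsilon> q by auto
      show "\<bar>?a s i\<bar> \<le> 1" using h by (intro abs_diff_le_unit mpois_bounds) auto
      show "\<bar>?A s i f\<bar> \<le> 1" for f by (rule abs_pmf_diff)
      show "\<bar>?A s i f - ?a s i\<bar> \<le> 2 * \<epsilon> * q ^ (m - Suc s)"
        if "f \<in> set_pmf (kiter K (Suc s) e)" "f \<in> H i" for f
      proof -
        \<comment> \<open>A hit ends in some \<open>H i\<close> again, so the induction hypothesis
          applies to the state from which the walk restarts, with fewer steps left.\<close>
        have "f \<in> V" using set_kiter[of V K e "Suc s", OF closed less.prems(2)] that(1) by blast
        then have "\<bar>pmf (hit_law K H (m - Suc s) f) y - mpois (real (m - Suc s) * h) y\<bar> \<le> \<epsilon> * q ^ (m - Suc s)" for y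
          using that(2) \<open>s < m\<close> less.prems(1) by (intro less.IH) auto
        from this[of x] this[of "x(i := x i - 1)"] show ?thesis by (simp add: abs_le_iff)
      qed
    qed
    define X where "X s i = measure_pmf.expectation (kiter K (Suc s) e) (\<lambda>f. of_bool (f \<in> H i) * ?A s i f)" for s i
    define a where "a s i = ?a s i" for s i
    define P where "P s i = \<bar>?P s i - h\<bar>" for s i
    define LX where "LX = (\<Sum>s<m. measure_pmf.expectation (kiter K (Suc s) e) (hit_jump K H (m - Suc s) x))"
    define LD where "LD = (\<Sum>j<m. mpois_diff (real j * h) x)"
    have E: "LX = (\<Sum>s<m. \<Sum>i\<in>UNIV. X s i)"
      unfolding LX_def X_def hit_jump_def
      by (intro sum.cong refl Bochner_Integration.integral_sum pmf_integrable_bounded[where B = 1])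
        (auto simp: abs_mult abs_pmf_diff)
    have D: "LD = (\<Sum>s<m. \<Sum>i\<in>UNIV. a s i)"
      unfolding LD_def a_def mpois_diff_def by (rule sum.nat_diff_reindex[symmetric])
    have "\<bar>LX - h * LD\<bar> = \<bar>\<Sum>s<m. \<Sum>i\<in>UNIV. X s i - h * a s i\<bar>"
      unfolding E D by (simp add: sum_subtractf sum_distrib_left)
    also have "\<dots> \<le> (\<Sum>s<m. \<Sum>i\<in>(UNIV::'r set). h * (2 * \<epsilon> * q ^ (m - Suc s)) + 3 * P s i)"
      unfolding X_def a_def P_def
      by (rule order_trans[OF sum_abs], rule sum_mono, rule order_trans[OF sum_abs], rule sum_mono, rule term_le) simp
    also have "\<dots> = (\<Sum>s<m. \<Sum>i\<in>(UNIV::'r set). h * (2 * \<epsilon> * q ^ (m - Suc s))) + (\<Sum>s<m. \<Sum>i\<in>UNIV. 3 * P s i)"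
      by (simp only: sum.distrib)
    also have "(\<Sum>s<m. \<Sum>i\<in>UNIV. 3 * P s i) = 3 * (\<Sum>i\<in>UNIV. \<Sum>s<m. P s i)"
      by (subst sum.swap) (simp only: sum_distrib_left)
    also have "(\<Sum>s<m. \<Sum>i\<in>(UNIV::'r set). h * (2 * \<epsilon> * q ^ (m - Suc s))) =
        2 * ?r * h * \<epsilon> * (\<Sum>s<m. q ^ (m - Suc s))"
      by (simp add: sum_distrib_left mult_ac)
    also have "(\<Sum>s<m. q ^ (m - Suc s)) = (\<Sum>j<m. q ^ j)"
      by (rule sum.nat_diff_reindex)
    \<comment> \<open>Because \<open>q - 1 = 2 * ?r * h\<close>, the accumulated feedback is exactly
      what separates \<open>\<epsilon>\<close> from \<open>\<epsilon> * q ^ m\<close>.\<close>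
    also have "2 * ?r * h * \<epsilon> * (\<Sum>j<m. q ^ j) = \<epsilon> * (q ^ m - 1)"
      by (simp only: power_diff_1_eq) (simp add: q_def)
    also have "(\<Sum>i\<in>(UNIV::'r set). \<Sum>s<m. P s i) \<le> (\<Sum>i\<in>(UNIV::'r set). \<eta>)"
    proof (rule sum_mono)
      fix i
      have "(\<Sum>s<m. P s i) \<le> (\<Sum>s<m0. P s i)"
        using less.prems(1) by (intro sum_mono2) (auto simp: P_def)
      also have "\<dots> \<le> \<eta>" unfolding P_def by (rule mix[OF less.prems(2,3)])
      finally show "(\<Sum>s<m. P s i) \<le> \<eta>" .
    qed
    finally have 1: "\<bar>LX - h * LD\<bar> \<le> \<epsilon> * (q ^ m - 1) + 3 * ?r * \<eta>"
      by simp
    have 2: "\<bar>mpois (real m * h) x - of_bool (x = (\<lambda>_. 0)) - h * LD\<bar>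
        \<le> real m0 * (2 * ?r\<^sup>2 * h\<^sup>2)"
      unfolding LD_def
      by (rule order_trans[OF mpois_euler[OF h]], rule mult_right_mono) (use less.prems(1) in auto)
    have "\<bar>of_bool (x = (\<lambda>_. 0)) + LX - mpois (real m * h) x\<bar> =
        \<bar>(LX - h * LD) - (mpois (real m * h) x - of_bool (x = (\<lambda>_. 0)) - h * LD)\<bar>"
      by (rule arg_cong[where f = abs]) simp
    also have "\<dots> \<le> \<epsilon> * (q ^ m - 1) + 3 * ?r * \<eta> + real m0 * (2 * ?r\<^sup>2 * h\<^sup>2)"
      by (rule order_trans[OF abs_triangle_ineq4 add_mono[OF 1 2]])
    also have "\<dots> = \<epsilon> * (q ^ m - 1) + \<epsilon>"
      by (simp only: \<epsilon>_def add.assoc)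
    also have "\<dots> = \<epsilon> * q ^ m" by (simp add: algebra_simps)
    finally show ?case
      unfolding LX_def by (subst pmf_hit_law_expand) (use disj in auto)
  qed
  then show ?thesis by (simp add: q_def \<epsilon>_def)
qed

section \<open>The non-backtracking walk as a Markov chain on lists\<close>

text \<open>States are whole trajectories. The previous vertex is then part of the state, and the
  first step, which has none, needs no separate state space.\<close>

definition nb_step :: "'v pair_pre_digraph \<Rightarrow> 'v list \<Rightarrow> 'v list pmf" where
  "nb_step G ws = map_pmf (\<lambda>w. ws @ [w]) (pmf_of_set (nb_next G ws))"

lemma nb_walk_kiter: "nb_walk G u k = kiter (nb_step G) k [u]"
proof (induction k)
  case (Suc k)
  show ?case unfolding kiter_Suc_right nb_walk.simps Suc.IH nb_step_def ..
qed simp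

lemma length_kiter_nb_step:
  "ws' \<in> set_pmf (kiter (nb_step G) m ws) \<Longrightarrow> length ws' = length ws + m"
  by (induction m arbitrary: ws) (auto simp: nb_step_def)

section \<open>Visits of a trajectory as hitting counts of the chain\<close>

lemma visits_snoc:
  assumes "ws \<noteq> []"
  shows "visits (length ws) (ws @ [w]) u = visits (length ws - 1) ws u + of_bool (w = u)"
proof -
  have len: "0 < length ws" using assms by simp
  have "{j. 1 \<le> j \<and> j \<le> length ws \<and> (ws @ [w]) ! j = u} =
    {j. 1 \<le> j \<and> j \<le> length ws - 1 \<and> ws ! j = u} \<union> (if w = u then {length ws} else {})"
    using len by (auto simp: nth_append Suc_le_eq split: if_splits)
  moreover have "finite {j. 1 \<le> j \<and> j \<le> length ws - 1 \<and> ws ! j = u}" by simp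
  moreover have "length ws \<notin> {j. 1 \<le> j \<and> j \<le> length ws - 1 \<and> ws ! j = u}" using len by auto
  ultimately show ?thesis by (simp add: visits_def)
qed

text \<open>Stated for an arbitrary nonempty history to make the induction work:
  \<open>length ws - 1\<close> is the time already elapsed, and the visits made up to then enter as
  a constant shift.\<close>

lemma visits_hit_law:
  assumes "ws \<noteq> []"
  shows "map_pmf (\<lambda>ws' i. int (visits (length ws' - 1) ws' (v i))) (kiter (nb_step G) m ws) =
    map_pmf (\<lambda>y i. y i + int (visits (length ws - 1) ws (v i)))
      (hit_law (nb_step G) (\<lambda>i. {ws. last ws = v i}) m ws)"
  using assms
proof (induction m arbitrary: ws)
  case 0
  show ?case by simp
next
  case (Suc m)
  let ?H = "\<lambda>i. {ws. last ws = v i}"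
  have "map_pmf (\<lambda>ws' i. int (visits (length ws' - 1) ws' (v i))) (kiter (nb_step G) m f) =
      map_pmf (\<lambda>y i. y i + int (visits (length ws - 1) ws (v i)))
        (map_pmf (\<lambda>y i. y i + of_bool (f \<in> ?H i)) (hit_law (nb_step G) ?H m f))"
    if "f \<in> set_pmf (nb_step G ws)" for f
  proof -
    from that obtain w where f: "f = ws @ [w]" by (auto simp: nb_step_def)
    have "int (visits (length f - 1) f (v i)) = of_bool (f \<in> ?H i) + int (visits (length ws - 1) ws (v i))" for i
      using visits_snoc[OF Suc.prems, of w "v i"] f by simp
    with Suc.IH[of f] f show ?thesis
      by (simp add: map_pmf_comp add.assoc)
  qed
  then show ?case
    by (simp add: map_bind_pmf cong: bind_pmf_cong)
qed

corollary visits_nb_walk: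
  "map_pmf (\<lambda>ws i. int (visits m ws (v i))) (nb_walk G u m) =
    hit_law (nb_step G) (\<lambda>i. {ws. last ws = v i}) m [u]"
proof -
  have "map_pmf (\<lambda>ws i. int (visits m ws (v i))) (nb_walk G u m) =
      map_pmf (\<lambda>ws i. int (visits (length ws - 1) ws (v i))) (kiter (nb_step G) m [u])"
    unfolding nb_walk_kiter by (rule map_pmf_cong) (auto dest: length_kiter_nb_step)
  also have "\<dots> = hit_law (nb_step G) (\<lambda>i. {ws. last ws = v i}) m [u]"
  proof -
    \<comment> \<open>The start occupies time 0, so the constant shift vanishes even when u is one
      of the targets.\<close>
    have "{j. 1 \<le> j \<and> j \<le> (0::nat) \<and> [u] ! j = w} = {}" for w by auto
    then have "visits 0 [u] w = 0" for w by (simp only: visits_def card.empty)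
    then show ?thesis by (subst visits_hit_law) (auto simp: pmf.map_id[unfolded id_def])
  qed
  finally show ?thesis .
qed

section \<open>Hitting probabilities and their recursions\<close>

definition nb_list :: "'v pair_pre_digraph \<Rightarrow> 'v list \<Rightarrow> bool" where
  "nb_list G ws \<longleftrightarrow> ws \<noteq> [] \<and> set ws \<subseteq> pverts G \<and>
     (\<forall>j. Suc j < length ws \<longrightarrow> (ws ! j, ws ! Suc j) \<in> parcs G) \<and>
     (\<forall>j. Suc (Suc j) < length ws \<longrightarrow> ws ! j \<noteq> ws ! Suc (Suc j))"

text \<open>For a walk standing at b after coming from a, the chance of being at v after k further
  steps, as a plain real recursion. \<open>nb_vertex_prob\<close> is the variant for a walk that has
  no previous vertex yet.\<close>

primrec nb_arc_prob :: "'v pair_pre_digraph \<Rightarrow> 'v \<Rightarrow> nat \<Rightarrow> 'v \<Rightarrow> 'v \<Rightarrow> real" where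
  "nb_arc_prob G v 0 a b = of_bool (b = v)"
| "nb_arc_prob G v (Suc k) a b =
     (\<Sum>w\<in>neighbours G b - {a}. nb_arc_prob G v k b w) / card (neighbours G b - {a})"

primrec nb_vertex_prob :: "'v pair_pre_digraph \<Rightarrow> 'v \<Rightarrow> nat \<Rightarrow> 'v \<Rightarrow> real" where
  "nb_vertex_prob G v 0 u = of_bool (u = v)"
| "nb_vertex_prob G v (Suc k) u =
     (\<Sum>w\<in>neighbours G u. nb_arc_prob G v k u w) / card (neighbours G u)"

lemma prob_kiter_Suc:
  "measure_pmf.prob (kiter K (Suc k) e) S =
    measure_pmf.expectation (K e) (\<lambda>f. measure_pmf.prob (kiter K k f) S)"
  using expectation_bind_bounded[of "indicator S" 1 "K e" "kiter K k"]
  by (auto simp: indicator_def)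

locale nb_regular = pair_graph G for G :: "'v pair_pre_digraph" +
  fixes d :: nat
  assumes regular: "regular_graph d G" and d3: "3 \<le> d"
begin

lemma neighbours_iff: "w \<in> neighbours G u \<longleftrightarrow> (u, w) \<in> parcs G"
  by (simp add: neighbours_def)

lemma parcs_sym: "(u, w) \<in> parcs G \<Longrightarrow> (w, u) \<in> parcs G"
  using arcs_symmetric by blast

lemma neighbours_sym: "w \<in> neighbours G u \<longleftrightarrow> u \<in> neighbours G w"
  using parcs_sym by (auto simp: neighbours_iff)

lemma neighbours_sub: "neighbours G u \<subseteq> pverts G"
  using in_arcsD2 by (auto simp: neighbours_iff)

lemma parcs_verts: "(u, w) \<in> parcs G \<Longrightarrow> u \<in> pverts G \<and> w \<in> pverts G"
  using in_arcsD1 in_arcsD2 by auto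

lemma finite_neighbours [simp]: "finite (neighbours G u)"
  using finite_subset[OF neighbours_sub] finite_verts by auto

lemma card_neighbours: "u \<in> pverts G \<Longrightarrow> card (neighbours G u) = d"
  using regular by (simp add: regular_graph_def)

lemma card_neighbours_diff:
  assumes "(a, b) \<in> parcs G"
  shows "card (neighbours G b - {a}) = d - 1"
  using assms parcs_verts[OF assms] parcs_sym[OF assms]
  by (simp add: card_Diff_singleton card_neighbours neighbours_iff)

lemma nb_list_last_verts: "nb_list G ws \<Longrightarrow> last ws \<in> pverts G"
  unfolding nb_list_def using last_in_set by blast

lemma nb_list_prev_arc:
  assumes "nb_list G ws" "2 \<le> length ws"
  shows "(ws ! (length ws - 2), last ws) \<in> parcs G"
proof -
  have "Suc (length ws - 2) = length ws - 1" using assms(2) by simp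
  then show ?thesis using assms unfolding nb_list_def
    by (metis Suc_diff_Suc diff_less last_conv_nth length_greater_0_conv lessI less_numeral_extra(1))
qed

lemma nb_next_card:
  assumes "nb_list G ws"
  shows "card (nb_next G ws) = (if length ws < 2 then d else d - 1)"
  using card_neighbours_diff nb_list_prev_arc[OF assms] card_neighbours nb_list_last_verts[OF assms]
  by (auto simp: nb_next_def)

lemma nb_next_nonempty:
  assumes "nb_list G ws"
  shows "nb_next G ws \<noteq> {}" "finite (nb_next G ws)"
proof -
  have "0 < card (nb_next G ws)" using nb_next_card[OF assms] d3 by auto
  then show "nb_next G ws \<noteq> {}" "finite (nb_next G ws)" by (auto simp: card_gt_0_iff)
qed

lemma nb_list_snoc:
  assumes "nb_list G ws" "w \<in> nb_next G ws"
  shows "nb_list G (ws @ [w])"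
proof -
  have ne: "ws \<noteq> []" using assms(1) by (simp add: nb_list_def)
  have arc: "(last ws, w) \<in> parcs G" using assms(2) by (auto simp: nb_next_def neighbours_iff split: if_splits)
  have nb: "w \<noteq> ws ! (length ws - 2)" if "2 \<le> length ws"
    using assms(2) that by (auto simp: nb_next_def)
  have 1: "((ws @ [w]) ! j, (ws @ [w]) ! Suc j) \<in> parcs G" if "Suc j < length (ws @ [w])" for j
  proof (cases "Suc j < length ws")
    case True
    then show ?thesis using assms(1) by (simp add: nb_list_def nth_append)
  next
    case False
    then have "j = length ws - 1" using that ne by auto
    then show ?thesis using arc ne by (simp add: nth_append last_conv_nth)
  qed
  have 2: "(ws @ [w]) ! j \<noteq> (ws @ [w]) ! Suc (Suc j)" if "Suc (Suc j) < length (ws @ [w])" for j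
  proof (cases "Suc (Suc j) < length ws")
    case True
    then show ?thesis using assms(1) by (simp add: nb_list_def nth_append)
  next
    case False
    then have "j = length ws - 2" "2 \<le> length ws" "Suc (Suc j) = length ws" using that by auto
    then show ?thesis using nb by (auto simp: nth_append)
  qed
  show ?thesis
    using assms(1) parcs_verts[OF arc] 1 2 unfolding nb_list_def by auto
qed

lemma nb_step_closed: "ws \<in> Collect (nb_list G) \<Longrightarrow> set_pmf (nb_step G ws) \<subseteq> Collect (nb_list G)"
  using nb_list_snoc nb_next_nonempty by (auto simp: nb_step_def)

lemma prob_nb_step_Suc:
  assumes "nb_list G ws"
  shows "measure_pmf.prob (kiter (nb_step G) (Suc k) ws) S =
    (\<Sum>w\<in>nb_next G ws. measure_pmf.prob (kiter (nb_step G) k (ws @ [w])) S) / card (nb_next G ws)"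
  unfolding prob_kiter_Suc nb_step_def[of G ws] integral_map_pmf
  by (rule integral_pmf_of_set) (use nb_next_nonempty[OF assms] in auto)

text \<open>Only the last two vertices of a history influence the future, which collapses the chain
  on lists to a function on arcs.\<close>

lemma prob_last_arc:
  assumes "nb_list G ws" "2 \<le> length ws"
  shows "measure_pmf.prob (kiter (nb_step G) k ws) {ws. last ws = v} =
    nb_arc_prob G v k (ws ! (length ws - 2)) (last ws)"
  using assms
proof (induction k arbitrary: ws)
  case 0
  then show ?case by (simp add: measure_return_pmf indicator_def)
next
  case (Suc k)
  have nx: "nb_next G ws = neighbours G (last ws) - {ws ! (length ws - 2)}"
    using Suc.prems by (simp add: nb_next_def)
  have "measure_pmf.prob (kiter (nb_step G) k (ws @ [w])) {ws. last ws = v} = nb_arc_prob G v k (last ws) w"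
    if "w \<in> nb_next G ws" for w
  proof -
    have "ws \<noteq> []" using Suc.prems by auto
    then show ?thesis
      using Suc.IH[OF nb_list_snoc[OF Suc.prems(1) that]] Suc.prems(2)
      by (simp add: nth_append last_conv_nth)
  qed
  then show ?case
    unfolding prob_nb_step_Suc[OF Suc.prems(1)] by (simp add: nx)
qed

lemma prob_last_vertex:
  assumes "u \<in> pverts G"
  shows "measure_pmf.prob (kiter (nb_step G) k [u]) {ws. last ws = v} = nb_vertex_prob G v k u"
proof (cases k)
  case 0
  then show ?thesis by (simp add: measure_return_pmf indicator_def)
next
  case (Suc j)
  have l: "nb_list G [u]" using assms by (simp add: nb_list_def)
  have "measure_pmf.prob (kiter (nb_step G) j [u, w]) {ws. last ws = v} = nb_arc_prob G v j u w"
    if "w \<in> neighbours G u" for w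
    using prob_last_arc[of "[u, w]" j v] nb_list_snoc[OF l, of w] that by (simp add: nb_next_def)
  then show ?thesis
    unfolding Suc prob_nb_step_Suc[OF l] by (simp add: nb_next_def)
qed

text \<open>The sum over permitted steps is the sum over all neighbours minus the forbidden step
  back to a; the full sum is what a walk without previous vertex would see.\<close>

lemma arc_recursion:
  assumes "(a, b) \<in> parcs G"
  shows "real (d - 1) * nb_arc_prob G v (Suc k) a b =
    real d * nb_vertex_prob G v (Suc k) b - nb_arc_prob G v k b a"
proof -
  have a: "a \<in> neighbours G b" using parcs_sym[OF assms] by (simp add: neighbours_iff)
  have "real (d - 1) * nb_arc_prob G v (Suc k) a b = (\<Sum>w\<in>neighbours G b - {a}. nb_arc_prob G v k b w)"
    using d3 card_neighbours_diff[OF assms] by simp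
  also have "\<dots> = (\<Sum>w\<in>neighbours G b. nb_arc_prob G v k b w) - nb_arc_prob G v k b a"
    using a by (simp add: sum.remove)
  also have "(\<Sum>w\<in>neighbours G b. nb_arc_prob G v k b w) = real d * nb_vertex_prob G v (Suc k) b"
    using d3 parcs_verts[OF assms] by (simp add: card_neighbours)
  finally show ?thesis .
qed

text \<open>A uniformly random previous vertex makes the first non-backtracking step uniform.\<close>

lemma sum_arcs_into:
  assumes "u \<in> pverts G"
  shows "(\<Sum>w\<in>neighbours G u. nb_arc_prob G v k w u) = real d * nb_vertex_prob G v k u"
proof (cases k)
  case 0
  then show ?thesis using card_neighbours[OF assms] by simp
next
  case (Suc j)
  let ?N = "neighbours G u"
  have S: "(\<Sum>w\<in>?N. nb_arc_prob G v j u w) = real d * nb_vertex_prob G v (Suc j) u"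
    using d3 assms by (simp add: card_neighbours)
  have "real (d - 1) * (\<Sum>w\<in>?N. nb_arc_prob G v (Suc j) w u) =
      (\<Sum>w\<in>?N. real d * nb_vertex_prob G v (Suc j) u - nb_arc_prob G v j u w)"
    unfolding sum_distrib_left
    by (rule sum.cong[OF refl], rule arc_recursion) (use neighbours_sym neighbours_iff in blast)
  also have "\<dots> = real d * (real d * nb_vertex_prob G v (Suc j) u) - real d * nb_vertex_prob G v (Suc j) u"
    unfolding sum_subtractf S using card_neighbours[OF assms] by simp
  also have "\<dots> = real (d - 1) * (real d * nb_vertex_prob G v (Suc j) u)"
    using d3 by (simp add: of_nat_diff algebra_simps del: nb_vertex_prob.simps)
  finally show ?thesis using d3 Suc by (simp del: nb_vertex_prob.simps nb_arc_prob.simps)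
qed

text \<open>The first step chooses among d neighbours, later ones among d - 1. This is why
  \<open>nb_poly\<close> and \<open>nb_mat\<close> have a separate clause for index 1.\<close>

lemma vertex_recursion_1:
  assumes "u \<in> pverts G"
  shows "nb_vertex_prob G v (Suc 0) u = (\<Sum>w\<in>neighbours G u. nb_vertex_prob G v 0 w) / real d"
  using assms by (simp add: card_neighbours)

text \<open>Summing \<open>arc_recursion\<close> over the first step, the forbidden returns combine
  by \<open>sum_arcs_into\<close> into a vertex probability. Arcs disappear, leaving a three-term
  recursion driven by the adjacency operator alone.\<close>

lemma vertex_recursion:
  assumes "u \<in> pverts G"
  shows "nb_vertex_prob G v (Suc (Suc k)) u =
    ((\<Sum>w\<in>neighbours G u. nb_vertex_prob G v (Suc k) w) - nb_vertex_prob G v k u) / real (d - 1)"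
proof -
  let ?N = "neighbours G u"
  have "real (d - 1) * (real d * nb_vertex_prob G v (Suc (Suc k)) u) =
      (\<Sum>w\<in>?N. real (d - 1) * nb_arc_prob G v (Suc k) u w)"
  proof -
    have "real d * nb_vertex_prob G v (Suc (Suc k)) u = (\<Sum>w\<in>?N. nb_arc_prob G v (Suc k) u w)"
      using d3 assms by (simp add: card_neighbours del: nb_arc_prob.simps)
    then show ?thesis by (simp only: sum_distrib_left)
  qed
  also have "\<dots> = (\<Sum>w\<in>?N. real d * nb_vertex_prob G v (Suc k) w - nb_arc_prob G v k w u)"
    by (rule sum.cong[OF refl], rule arc_recursion) (simp add: neighbours_iff)
  also have "\<dots> = real d * (\<Sum>w\<in>?N. nb_vertex_prob G v (Suc k) w) - real d * nb_vertex_prob G v k u"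
    unfolding sum_subtractf sum_arcs_into[OF assms] sum_distrib_left ..
  finally have "real d * (real (d - 1) * nb_vertex_prob G v (Suc (Suc k)) u) =
      real d * ((\<Sum>w\<in>?N. nb_vertex_prob G v (Suc k) w) - nb_vertex_prob G v k u)"
    by (simp only: right_diff_distrib mult_ac)
  then show ?thesis using d3
    by (simp add: nonzero_eq_divide_eq mult.commute del: nb_vertex_prob.simps nb_arc_prob.simps)
qed

end

section \<open>Non-backtracking polynomials and triangular matrices\<close>

text \<open>For k > 0 this is the polynomial whose value at the adjacency matrix counts
  non-backtracking walks of length k, divided by their number d (d - 1)^(k - 1) from a fixed
  vertex.\<close>

fun nb_poly :: "nat \<Rightarrow> nat \<Rightarrow> real \<Rightarrow> real" where
  "nb_poly d 0 x = 1"
| "nb_poly d (Suc 0) x = x / real d"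
| "nb_poly d (Suc (Suc k)) x = (x * nb_poly d (Suc k) x - nb_poly d k x) / real (d - 1)"

lemma nb_poly_degree:
  assumes "2 \<le> d"
  shows "nb_poly d k (real d) = 1"
  using assms by (induction d k "real d" rule: nb_poly.induct) (auto simp: of_nat_diff)

text \<open>The roots of z^2 - (x / D) z + 1 / D. A nonpositive discriminant gives conjugate roots
  of modulus 1 / sqrt D; otherwise they are real and the larger modulus increases with |x|. Complex
  numbers let both cases continue together.\<close>

lemma quadratic_roots_bound:
  fixes D lam x :: real
  assumes "0 < D" "\<bar>x\<bar> \<le> lam"
    and "1 / sqrt D \<le> \<rho>" "(lam + sqrt (max 0 (lam\<^sup>2 - 4 * D))) / (2 * D) \<le> \<rho>"
  obtains \<alpha> \<beta> :: complex
  where "\<alpha> + \<beta> = of_real (x / D)" "\<alpha> * \<beta> = of_real (1 / D)" "norm \<alpha> \<le> \<rho>" "norm \<beta> \<le> \<rho>"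
proof (cases "x\<^sup>2 - 4 * D \<le> 0")
  case True
  define s where "s = sqrt (4 * D - x\<^sup>2)"
  have s: "s\<^sup>2 = 4 * D - x\<^sup>2" using True by (simp add: s_def)
  define \<alpha> where "\<alpha> = Complex (x / (2 * D)) (s / (2 * D))"
  have n: "norm \<alpha> = 1 / sqrt D"
  proof -
    have "(x / (2 * D))\<^sup>2 + (s / (2 * D))\<^sup>2 = 1 / D"
      unfolding power_divide s using assms(1) by (simp add: field_simps power2_eq_square)
    then show ?thesis by (simp add: \<alpha>_def cmod_def real_sqrt_divide)
  qed
  show ?thesis
  proof
    show "\<alpha> + cnj \<alpha> = of_real (x / D)" by (simp add: \<alpha>_def complex_eq_iff)
    show "\<alpha> * cnj \<alpha> = of_real (1 / D)"
      unfolding complex_norm_square[symmetric] n using assms(1) by (simp add: power_divide)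
  qed (use n assms(3) in auto)
next
  case False
  define s where "s = sqrt (x\<^sup>2 - 4 * D)"
  have s: "s\<^sup>2 = x\<^sup>2 - 4 * D" "0 \<le> s" using False by (auto simp: s_def)
  have "x\<^sup>2 \<le> lam\<^sup>2" using assms(2) by (metis abs_ge_zero power2_abs power_mono)
  then have "s \<le> sqrt (max 0 (lam\<^sup>2 - 4 * D))" unfolding s_def by (intro real_sqrt_le_mono) auto
  then have le: "\<bar>y\<bar> / (2 * D) \<le> \<rho>" if "\<bar>y\<bar> \<le> \<bar>x\<bar> + s" for y
    using that assms(1,2) by (intro order_trans[OF divide_right_mono assms(4)]) auto
  show ?thesis
  proof
    show "of_real ((x + s) / (2 * D)) + of_real ((x - s) / (2 * D)) = (of_real (x / D) :: complex)"
      unfolding of_real_add[symmetric] by (simp add: add_divide_distrib[symmetric] del: of_real_add)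
    show "of_real ((x + s) / (2 * D)) * of_real ((x - s) / (2 * D)) = (of_real (1 / D) :: complex)"
      unfolding of_real_mult[symmetric]
    proof (rule arg_cong[where f = of_real])
      have "(x + s) * (x - s) = 4 * D" using s(1) by (simp add: algebra_simps power2_eq_square)
      then show "(x + s) / (2 * D) * ((x - s) / (2 * D)) = 1 / D"
        using assms(1) by (simp add: power2_eq_square divide_simps)
    qed
    show "norm (of_real ((x + s) / (2 * D)) :: complex) \<le> \<rho>"
      "norm (of_real ((x - s) / (2 * D)) :: complex) \<le> \<rho>"
      using le[of "x + s"] le[of "x - s"] s(2) assms(1)
      by (auto simp: abs_divide simp del: of_real_divide of_real_add of_real_diff)
  qed
qed

text \<open>With p for the polynomial values, p(k+1) - \<alpha> p(k) is multiplied by \<beta> at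
  each step, and solving back for p costs a factor linear in k. Unlike the closed formula in
  \<alpha> and \<beta>, this does not degenerate at a double root.\<close>

lemma nb_poly_linear_bound:
  assumes "2 \<le> d" "\<bar>x\<bar> \<le> real d" "0 < \<rho>" "\<rho> \<le> 1"
    and \<alpha>\<beta>: "\<alpha> + \<beta> = complex_of_real (x / real (d - 1))" "\<alpha> * \<beta> = of_real (1 / real (d - 1))"
      "norm \<alpha> \<le> \<rho>" "norm \<beta> \<le> \<rho>"
  shows "\<bar>nb_poly d k x\<bar> \<le> (1 + 2 / \<rho> * k) * \<rho> ^ k"
proof -
  let ?z = "\<lambda>k. complex_of_real (nb_poly d k x)"
  have diff: "norm (?z (Suc k) - \<alpha> * ?z k) \<le> 2 * \<rho> ^ k" for k
  proof (induction k)
    case 0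
    have "norm (complex_of_real (x / real d)) \<le> 1" using assms(1,2) by (simp add: norm_divide)
    then have "norm (of_real (x / real d) - \<alpha>) \<le> 1 + 1"
      by (intro order_trans[OF norm_triangle_ineq4] add_mono) (use assms in auto)
    then show ?case by simp
  next
    case (Suc k)
    have "?z (Suc (Suc k)) = of_real (x / real (d - 1)) * ?z (Suc k) - of_real (1 / real (d - 1)) * ?z k"
      by (simp only: of_real_mult[symmetric] of_real_diff[symmetric], rule arg_cong[where f = of_real])
        (simp add: diff_divide_distrib)
    also have "\<dots> = (\<alpha> + \<beta>) * ?z (Suc k) - \<alpha> * \<beta> * ?z k" by (simp only: \<alpha>\<beta>)
    finally have "?z (Suc (Suc k)) - \<alpha> * ?z (Suc k) = \<beta> * (?z (Suc k) - \<alpha> * ?z k)"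
      by (simp add: algebra_simps)
    then have "norm (?z (Suc (Suc k)) - \<alpha> * ?z (Suc k)) = norm \<beta> * norm (?z (Suc k) - \<alpha> * ?z k)"
      by (simp only: norm_mult)
    also have "\<dots> \<le> \<rho> * (2 * \<rho> ^ k)" by (intro mult_mono Suc \<alpha>\<beta>) (use assms in auto)
    finally show ?case by simp
  qed
  have "norm (?z k) \<le> (1 + 2 / \<rho> * k) * \<rho> ^ k"
  proof (induction k)
    case (Suc k)
    have "norm (?z (Suc k)) \<le> norm (?z (Suc k) - \<alpha> * ?z k) + norm (\<alpha> * ?z k)"
      by (metis norm_triangle_ineq diff_add_cancel)
    also have "\<dots> \<le> 2 * \<rho> ^ k + \<rho> * ((1 + 2 / \<rho> * k) * \<rho> ^ k)"
      unfolding norm_mult by (intro add_mono diff mult_mono Suc \<alpha>\<beta>) (use assms in auto)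
    also have "\<dots> = (1 + 2 / \<rho> * Suc k) * \<rho> ^ Suc k"
      using assms(3) by (simp add: field_simps)
    finally show ?case .
  qed simp
  then show ?thesis by simp
qed

lemma nb_poly_geometric_bound:
  fixes lam :: real
  assumes "3 \<le> d" "lam < real d"
  obtains C \<rho> where "1 \<le> C" "3 / 4 \<le> \<rho>" "\<rho> < 1"
    "\<And>x k. \<bar>x\<bar> \<le> lam \<Longrightarrow> \<bar>nb_poly d k x\<bar> \<le> C * \<rho> ^ k"
proof -
  define D where "D = real (d - 1)"
  have D: "2 \<le> D" "real d = D + 1" using assms(1) by (auto simp: D_def of_nat_diff)
  define u where "u = (lam + sqrt (max 0 (lam\<^sup>2 - 4 * D))) / (2 * D)"
  \<comment> \<open>The floor 3 / 4 serves \<open>arc_mixing\<close>, where an exponent has to be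
    raised by one at the bounded cost 4 / 3.\<close>
  define \<rho> where "\<rho> = max (3 / 4) (max (1 / sqrt D) u)"
  have \<rho>: "3 / 4 \<le> \<rho>" "1 / sqrt D \<le> \<rho>" "u \<le> \<rho>" by (auto simp: \<rho>_def)
  show ?thesis
  proof (cases "0 \<le> lam")
    case False
    show ?thesis by (rule that[of 1 "3 / 4"]) (use False in auto)
  next
    case True
    have "lam\<^sup>2 < (D + 1)\<^sup>2" using True assms(2) D by (intro power_strict_mono) auto
    \<comment> \<open>As (D + 1)^2 - 4 D = (D - 1)^2, the condition lam < d = D + 1 keeps u below
      ((D + 1) + (D - 1)) / (2 D) = 1.\<close>
    then have "lam\<^sup>2 - 4 * D < (D - 1)\<^sup>2" by (simp add: power2_eq_square algebra_simps)
    then have "sqrt (max 0 (lam\<^sup>2 - 4 * D)) < D - 1"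
      using D(1) by (intro real_less_lsqrt) auto
    then have "u < 1" using assms(2) D by (simp add: u_def)
    moreover have "1 / sqrt D < 1" using D by simp
    ultimately have \<rho>1: "\<rho> < 1" by (simp add: \<rho>_def)
    have lin: "\<bar>nb_poly d k x\<bar> \<le> (1 + 2 / \<rho> * k) * \<rho> ^ k" if x: "\<bar>x\<bar> \<le> lam" for x k
    proof -
      have "0 < D" using D by simp
      from quadratic_roots_bound[OF this x \<rho>(2) \<rho>(3)[unfolded u_def]]
      obtain \<alpha> \<beta> :: complex where "\<alpha> + \<beta> = of_real (x / D)" "\<alpha> * \<beta> = of_real (1 / D)"
        "norm \<alpha> \<le> \<rho>" "norm \<beta> \<le> \<rho>" by metis
      note ab = this[unfolded D_def]
      show ?thesis
        by (rule nb_poly_linear_bound[OF _ _ _ _ ab]) (use assms x \<rho> \<rho>1 in linarith)+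
    qed
    \<comment> \<open>Any rate strictly between \<rho> and 1 absorbs the linear factor.\<close>
    define \<sigma> where "\<sigma> = (1 + \<rho>) / 2"
    have \<sigma>: "\<rho> < \<sigma>" "\<sigma> < 1" "0 < \<sigma>" using \<rho>1 \<rho>(1) by (auto simp: \<sigma>_def)
    let ?t = "\<lambda>k::nat. (1 + 2 / \<rho> * k) * (\<rho> / \<sigma>) ^ k"
    have q: "norm (\<rho> / \<sigma>) < 1" using \<sigma> \<rho>(1) by simp
    have "(\<lambda>k. (\<rho> / \<sigma>) ^ k + 2 / \<rho> * (of_nat k * (\<rho> / \<sigma>) ^ k)) \<longlonglongrightarrow> 0 + 2 / \<rho> * 0"
      by (intro tendsto_intros powser_times_n_limit_0 q LIMSEQ_power_zero)
    then have "Bseq ?t"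
      by (intro convergent_imp_Bseq) (auto simp: convergent_def algebra_simps)
    then obtain C where C: "0 < C" "\<And>k. \<bar>?t k\<bar> \<le> C" by (auto simp: Bseq_def)
    show ?thesis
    proof (rule that[of "max 1 C" \<sigma>])
      fix x k assume "\<bar>x\<bar> \<le> lam"
      then have "\<bar>nb_poly d k x\<bar> \<le> (1 + 2 / \<rho> * k) * \<rho> ^ k" by (rule lin)
      also have "\<dots> = ?t k * \<sigma> ^ k" using \<sigma> by (simp add: power_divide)
      also have "\<dots> \<le> max 1 C * \<sigma> ^ k"
        using C(2)[of k] \<sigma> by (intro mult_right_mono) auto
      finally show "\<bar>nb_poly d k x\<bar> \<le> max 1 C * \<sigma> ^ k" .
    qed (use \<sigma> \<rho>(1) in auto)
  qed
qed

section \<open>Trace and simultaneous triangular form\<close>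

lemma index_mult_mat_sum:
  assumes "A \<in> carrier_mat n m" "B \<in> carrier_mat m l" "i < n" "j < l"
  shows "(A * B) $$ (i, j) = (\<Sum>k<m. A $$ (i, k) * B $$ (k, j))"
  using assms by (auto simp: scalar_prod_def atLeast0LessThan intro!: sum.cong)

definition mat_trace :: "'a::comm_monoid_add mat \<Rightarrow> 'a" where
  "mat_trace A = (\<Sum>i<dim_row A. A $$ (i, i))"

lemma mat_trace_comm:
  fixes A B :: "'a::comm_semiring_0 mat"
  assumes "A \<in> carrier_mat n n" "B \<in> carrier_mat n n"
  shows "mat_trace (A * B) = mat_trace (B * A)"
proof -
  have "mat_trace (A * B) = (\<Sum>i<n. \<Sum>k<n. A $$ (i, k) * B $$ (k, i))"
    using assms by (auto simp: mat_trace_def index_mult_mat_sum[OF assms] simp del: index_mult_mat(1) intro!: sum.cong)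
  also have "\<dots> = (\<Sum>i<n. \<Sum>k<n. B $$ (i, k) * A $$ (k, i))"
    by (subst sum.swap) (simp add: mult.commute)
  also have "\<dots> = mat_trace (B * A)"
    using assms by (auto simp: mat_trace_def index_mult_mat_sum[OF assms(2,1)] simp del: index_mult_mat(1) intro!: sum.cong)
  finally show ?thesis .
qed

locale triangularisation =
  fixes n :: nat and P Q :: "'a::comm_ring_1 mat"
  assumes P: "P \<in> carrier_mat n n" and Q: "Q \<in> carrier_mat n n"
    and PQ: "P * Q = 1\<^sub>m n" and QP: "Q * P = 1\<^sub>m n"
begin

text \<open>P and Q are fixed, so matrices triangular in this common basis form an algebra in which
  diagonals are added and multiplied entrywise. Hence a polynomial in A has the polynomial values of
  the eigenvalues on its diagonal, with multiplicity.\<close>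

definition tri :: "'a mat \<Rightarrow> (nat \<Rightarrow> 'a) \<Rightarrow> bool" where
  "tri M f \<longleftrightarrow> (\<exists>T \<in> carrier_mat n n. upper_triangular T \<and> (\<forall>i<n. T $$ (i, i) = f i) \<and> M = P * T * Q)"

lemma triI: "T \<in> carrier_mat n n \<Longrightarrow> upper_triangular T \<Longrightarrow> (\<And>i. i < n \<Longrightarrow> T $$ (i, i) = f i) \<Longrightarrow>
    M = P * T * Q \<Longrightarrow> tri M f"
  unfolding tri_def by blast

lemma tri_carrier: "tri M f \<Longrightarrow> M \<in> carrier_mat n n"
  using P Q by (auto simp: tri_def)

lemma tri_one: "tri (1\<^sub>m n) (\<lambda>_. 1)"
  by (rule triI[of "1\<^sub>m n"]) (use P Q PQ in auto)

lemma tri_smult: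
  assumes "tri M f"
  shows "tri (c \<cdot>\<^sub>m M) (\<lambda>i. c * f i)"
proof -
  obtain T where T: "T \<in> carrier_mat n n" "upper_triangular T" "\<forall>i<n. T $$ (i, i) = f i" "M = P * T * Q"
    using assms by (auto simp: tri_def)
  have "c \<cdot>\<^sub>m M = P * (c \<cdot>\<^sub>m T) * Q"
    unfolding T(4) mult_smult_distrib[OF P T(1)]
    by (rule mult_smult_assoc_mat[OF mult_carrier_mat[OF P T(1)] Q, symmetric])
  then show ?thesis using T by (intro triI[of "c \<cdot>\<^sub>m T"]) (auto intro!: upper_triangularI dest: upper_triangularD)
qed

lemma tri_minus:
  assumes "tri M f" "tri N g"
  shows "tri (M - N) (\<lambda>i. f i - g i)"
proof -
  obtain T where T: "T \<in> carrier_mat n n" "upper_triangular T" "\<forall>i<n. T $$ (i, i) = f i" "M = P * T * Q"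
    using assms(1) by (auto simp: tri_def)
  obtain S where S: "S \<in> carrier_mat n n" "upper_triangular S" "\<forall>i<n. S $$ (i, i) = g i" "N = P * S * Q"
    using assms(2) by (auto simp: tri_def)
  have "M - N = P * (T - S) * Q"
    unfolding T(4) S(4) mult_minus_distrib_mat[OF P T(1) S(1)]
    by (rule minus_mult_distrib_mat[OF mult_carrier_mat[OF P T(1)] mult_carrier_mat[OF P S(1)] Q, symmetric])
  then show ?thesis using T S upper_triangularD[OF T(2)] upper_triangularD[OF S(2)]
    by (intro triI[of "T - S"]) (auto intro!: upper_triangularI)
qed

lemma tri_mult:
  assumes "tri M f" "tri N g"
  shows "tri (M * N) (\<lambda>i. f i * g i)"
proof -
  obtain T where T: "T \<in> carrier_mat n n" "upper_triangular T" "\<forall>i<n. T $$ (i, i) = f i" "M = P * T * Q"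
    using assms(1) by (auto simp: tri_def)
  obtain S where S: "S \<in> carrier_mat n n" "upper_triangular S" "\<forall>i<n. S $$ (i, i) = g i" "N = P * S * Q"
    using assms(2) by (auto simp: tri_def)
  note c = P Q T(1) S(1)
  have PT: "P * T \<in> carrier_mat n n" and SQ: "S * Q \<in> carrier_mat n n" using c by auto
  have "M * N = P * T * (Q * (P * (S * Q)))"
    unfolding T(4) S(4) assoc_mult_mat[OF P S(1) Q]
    by (rule assoc_mult_mat[OF PT Q mult_carrier_mat[OF P SQ]])
  also have "Q * (P * (S * Q)) = S * Q"
    by (rule assoc_mult_mat[OF Q P SQ, unfolded QP left_mult_one_mat[OF SQ], symmetric])
  also have "P * T * (S * Q) = P * T * S * Q"
    by (rule assoc_mult_mat[OF PT S(1) Q, symmetric])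
  also have "P * T * S = P * (T * S)"
    by (rule assoc_mult_mat[OF P T(1) S(1)])
  finally have 1: "M * N = P * (T * S) * Q" .
  have TS: "(T * S) $$ (i, j) = (\<Sum>k<n. T $$ (i, k) * S $$ (k, j))" if "i < n" "j < n" for i j
    by (rule index_mult_mat_sum[OF T(1) S(1) that])
  have z: "T $$ (i, k) = 0" if "k < i" "i < n" for i k using T(1,2) that by auto
  have z': "S $$ (i, k) = 0" if "k < i" "i < n" for i k using S(1,2) that by auto
  show ?thesis
  proof (rule triI[OF _ _ _ 1])
    show "T * S \<in> carrier_mat n n" using c by simp
    show "upper_triangular (T * S)"
    proof (rule upper_triangularI)
      fix i j assume *: "j < i" "i < dim_row (T * S)"
      then have "i < n" "j < n" using T(1) by auto
      then show "(T * S) $$ (i, j) = 0"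
        unfolding TS[OF \<open>i < n\<close> \<open>j < n\<close>]
      proof (intro sum.neutral ballI)
        fix k assume k: "k \<in> {..<n}"
        show "T $$ (i, k) * S $$ (k, j) = 0"
          using z[of k i] z'[of j k] k * \<open>i < n\<close> by (cases "k < i") auto
      qed
    qed
    fix i assume i: "i < n"
    have "(T * S) $$ (i, i) = (\<Sum>k\<in>{i}. T $$ (i, k) * S $$ (k, i))"
      unfolding TS[OF i i]
    proof (rule sum.mono_neutral_right)
      show "\<forall>k\<in>{..<n} - {i}. T $$ (i, k) * S $$ (k, i) = 0"
      proof
        fix k assume "k \<in> {..<n} - {i}"
        then consider "k < i" | "i < k" "k < n" by force
        then show "T $$ (i, k) * S $$ (k, i) = 0" using i z z' by cases auto
      qed
    qed (use i in auto)
    then show "(T * S) $$ (i, i) = f i * g i" using T(3) S(3) i by simp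
  qed
qed

lemma tri_trace:
  assumes "tri M f"
  shows "mat_trace M = (\<Sum>i<n. f i)"
proof -
  obtain T where T: "T \<in> carrier_mat n n" "\<forall>i<n. T $$ (i, i) = f i" "M = P * T * Q"
    using assms by (auto simp: tri_def)
  have "mat_trace M = mat_trace (Q * (P * T))"
    unfolding T(3) by (rule mat_trace_comm) (use P Q T(1) in auto)
  also have "Q * (P * T) = T"
    using assoc_mult_mat[OF Q P T(1)] T(1) by (simp add: QP)
  finally show ?thesis using T by (simp add: mat_trace_def)
qed

end

section \<open>Entries of polynomials in the adjacency matrix\<close>

fun nb_mat :: "nat \<Rightarrow> nat \<Rightarrow> real mat \<Rightarrow> real mat" where
  "nb_mat d 0 A = 1\<^sub>m (dim_row A)"
| "nb_mat d (Suc 0) A = (1 / real d) \<cdot>\<^sub>m A"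
| "nb_mat d (Suc (Suc k)) A = (1 / real (d - 1)) \<cdot>\<^sub>m (A * nb_mat d (Suc k) A - nb_mat d k A)"

lemma nb_mat_carrier:
  assumes "A \<in> carrier_mat n n"
  shows "nb_mat d k A \<in> carrier_mat n n"
  using assms by (induction d k A rule: nb_mat.induct) auto

lemma transpose_smult_mat: "transpose_mat (c \<cdot>\<^sub>m M) = c \<cdot>\<^sub>m transpose_mat M"
  by (rule eq_matI) auto

text \<open>Commutation with A is carried along because transposing \<open>A * M\<close> reverses
  the factors.\<close>

lemma nb_mat_symmetric:
  assumes A: "A \<in> carrier_mat n n" "transpose_mat A = A"
  shows "transpose_mat (nb_mat d k A) = nb_mat d k A \<and> A * nb_mat d k A = nb_mat d k A * A"
  using A
proof (induction d k A rule: nb_mat.induct)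
  case (1 d A)
  then show ?case by auto
next
  case (2 d A)
  then show ?case
    by (auto simp: transpose_smult_mat mult_smult_distrib[of A n n] mult_smult_assoc_mat[of A n n])
next
  case (3 d k A)
  let ?M = "nb_mat d (Suc k) A" and ?L = "nb_mat d k A"
  have A: "A \<in> carrier_mat n n" and M: "?M \<in> carrier_mat n n" and L: "?L \<in> carrier_mat n n"
    using 3 nb_mat_carrier by auto
  have AM: "A * ?M \<in> carrier_mat n n" and D: "A * ?M - ?L \<in> carrier_mat n n" using A M L by auto
  note IH = 3(1,2)[OF 3(3,4)]
  have "transpose_mat (A * ?M) = A * ?M"
    using transpose_mult[OF A M] IH 3(4) by simp
  then have "transpose_mat (A * ?M - ?L) = A * ?M - ?L"
    using transpose_minus[OF AM L] IH by simp
  moreover have "A * (A * ?M - ?L) = (A * ?M - ?L) * A"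
    using IH mult_minus_distrib_mat[OF A AM L] minus_mult_distrib_mat[OF AM L A]
      assoc_mult_mat[OF A M A] by simp
  ultimately show ?case
    using mult_smult_distrib[OF A D] mult_smult_assoc_mat[OF D A] by (simp add: transpose_smult_mat)
qed

text \<open>All columns of K lie in the eigenspace of A for d, on which \<open>nb_mat d k A\<close>
  acts as multiplication by \<open>nb_poly d k d\<close>, that is 1.\<close>

lemma nb_mat_fix:
  assumes A: "A \<in> carrier_mat n n" and K: "K \<in> carrier_mat n n"
    and eig: "A * K = real d \<cdot>\<^sub>m K" and d: "2 \<le> d"
  shows "nb_mat d k A * K = K"
  using A eig d
proof (induction d k A rule: nb_mat.induct)
  case (1 d A)
  then show ?case using K by auto
next
  case (2 d A)
  then show ?case using K by (auto simp: mult_smult_assoc_mat[of A n n])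
next
  case (3 d k A)
  let ?M = "nb_mat d (Suc k) A" and ?L = "nb_mat d k A"
  have A: "A \<in> carrier_mat n n" and M: "?M \<in> carrier_mat n n" and L: "?L \<in> carrier_mat n n"
    using 3 nb_mat_carrier by auto
  have AM: "A * ?M \<in> carrier_mat n n" using A M by auto
  have "(A * ?M - ?L) * K = A * (?M * K) - ?L * K"
    using minus_mult_distrib_mat[OF AM L K] assoc_mult_mat[OF A M K] by simp
  also have "\<dots> = real d \<cdot>\<^sub>m K - K" using 3 by simp
  finally have "(A * ?M - ?L) * K = real d \<cdot>\<^sub>m K - K" .
  moreover have "(1 / real (d - 1)) \<cdot>\<^sub>m (real d \<cdot>\<^sub>m K - K) = K"
    using K 3(5) by (intro eq_matI) (auto simp: of_nat_diff field_simps)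
  moreover have "((1 / real (d - 1)) \<cdot>\<^sub>m (A * ?M - ?L)) * K = (1 / real (d - 1)) \<cdot>\<^sub>m ((A * ?M - ?L) * K)"
    by (rule mult_smult_assoc_mat[OF _ K]) (use AM L in auto)
  ultimately show ?case by simp
qed

lemma tri_nb_mat:
  assumes "triangularisation n P Q" "triangularisation.tri n P Q A f"
  shows "triangularisation.tri n P Q (nb_mat d k A) (\<lambda>i. nb_poly d k (f i))"
proof -
  interpret triangularisation n P Q by fact
  have n: "dim_row A = n" using tri_carrier[OF assms(2)] by simp
  show ?thesis
    using assms(2) n
  proof (induction d k A rule: nb_mat.induct)
    case (1 d A)
    then show ?case using tri_one by simp
  next
    case (2 d A)
    then show ?case using tri_smult[of A f "1 / real d"] by simp
  next
    case (3 d k A)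
    from tri_smult[OF tri_minus[OF tri_mult[OF 3(3) 3(1)[OF 3(3,4)]] 3(2)[OF 3(3,4)]], of "1 / real (d - 1)"]
    show ?case by simp
  qed
qed

section \<open>Entry bounds by repeated squaring\<close>

primrec repeated_square :: "'a::semiring_1 mat \<Rightarrow> nat \<Rightarrow> 'a mat" where
  "repeated_square B 0 = B"
| "repeated_square B (Suc j) = repeated_square B j * repeated_square B j"

lemma repeated_square_carrier:
  "B \<in> carrier_mat n n \<Longrightarrow> repeated_square B j \<in> carrier_mat n n"
  by (induction j) auto

lemma repeated_square_symmetric:
  fixes B :: "real mat"
  assumes "B \<in> carrier_mat n n" "transpose_mat B = B"
  shows "transpose_mat (repeated_square B j) = repeated_square B j"
proof (induction j)
  case (Suc j)
  note c = repeated_square_carrier[OF assms(1), of j]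
  show ?case using transpose_mult[OF c c] Suc by simp
qed (use assms in simp)

lemma symmetric_square_diag:
  fixes B :: "real mat"
  assumes B: "B \<in> carrier_mat n n" "transpose_mat B = B" and "u < n"
  shows "(B * B) $$ (u, u) = (\<Sum>k<n. (B $$ (u, k))\<^sup>2)"
proof -
  have "B $$ (k, u) = B $$ (u, k)" if "k < n" for k
    using B that assms(3) index_transpose_mat(1)[of u B k] by auto
  then show ?thesis
    using index_mult_mat_sum[OF B(1) B(1) assms(3) assms(3)] by (simp add: power2_eq_square)
qed

lemma symmetric_square_entry:
  fixes B :: "real mat"
  assumes "B \<in> carrier_mat n n" "transpose_mat B = B" "u < n" "v < n"
  shows "(B $$ (u, v))\<^sup>2 \<le> (B * B) $$ (u, u)"
  unfolding symmetric_square_diag[OF assms(1-3)]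
  by (rule member_le_sum) (use assms in auto)

text \<open>The square of an entry is at most the diagonal entry of the squared matrix in its row;
  from there on the diagonal entry itself is squared. The count starts at \<open>Suc j\<close>
  because only squares are sure to have a nonnegative diagonal, which the passage to the trace
  needs.\<close>

lemma entry_power_le_trace:
  fixes B :: "real mat"
  assumes B: "B \<in> carrier_mat n n" "transpose_mat B = B" and uv: "u < n" "v < n"
  shows "\<bar>B $$ (u, v)\<bar> ^ (2 ^ Suc j) \<le> mat_trace (repeated_square B (Suc j))"
proof -
  note c = repeated_square_carrier[OF B(1)] and s = repeated_square_symmetric[OF B]
  have "\<bar>B $$ (u, v)\<bar> ^ (2 ^ Suc j) \<le> repeated_square B (Suc j) $$ (u, u)"
  proof (induction j)
    case 0
    show ?case using symmetric_square_entry[OF B uv] by simp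
  next
    case (Suc j)
    have "\<bar>B $$ (u, v)\<bar> ^ (2 ^ Suc (Suc j)) = (\<bar>B $$ (u, v)\<bar> ^ (2 ^ Suc j))\<^sup>2"
      by (simp add: power_mult[symmetric] mult.commute)
    also have "\<dots> \<le> (repeated_square B (Suc j) $$ (u, u))\<^sup>2"
      by (intro power_mono Suc) simp
    also have "\<dots> \<le> repeated_square B (Suc (Suc j)) $$ (u, u)"
      by (subst repeated_square.simps(2)[of B "Suc j"]) (rule symmetric_square_entry[OF c s uv(1) uv(1)])
    finally show ?case .
  qed
  also have "\<dots> \<le> (\<Sum>i<n. repeated_square B (Suc j) $$ (i, i))"
  proof (rule member_le_sum)
    show "0 \<le> repeated_square B (Suc j) $$ (i, i)" if "i \<in> {..<n} - {u}" for i
    proof -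
      have i: "i < n" using that by simp
      show ?thesis
        unfolding repeated_square.simps(2) symmetric_square_diag[OF c s i] by (intro sum_nonneg) auto
    qed
  qed (use uv in auto)
  also have "\<dots> = mat_trace (repeated_square B (Suc j))"
    using c[of "Suc j"] by (simp add: mat_trace_def del: repeated_square.simps)
  finally show ?thesis .
qed

text \<open>K is idempotent and absorbs S from both sides, so (R - K)^2 = R^2 - K - K + K for every
  repeated square R of S.\<close>

lemma repeated_square_minus:
  fixes S K :: "real mat"
  assumes S: "S \<in> carrier_mat n n" and K: "K \<in> carrier_mat n n"
    and "S * K = K" "K * S = K" "K * K = K"
  shows "repeated_square (S - K) j = repeated_square S j - K \<and>
    repeated_square S j * K = K \<and> K * repeated_square S j = K"
proof (induction j)
  case (Suc j)
  let ?R = "repeated_square S j"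
  have R: "?R \<in> carrier_mat n n" by (rule repeated_square_carrier[OF S])
  have RR: "?R * ?R \<in> carrier_mat n n" and RK: "?R - K \<in> carrier_mat n n" using R K by auto
  have "repeated_square (S - K) (Suc j) = (?R - K) * (?R - K)" using Suc by simp
  also have "\<dots> = (?R * ?R - ?R * K) - (K * ?R - K * K)"
    using minus_mult_distrib_mat[OF R K RK] mult_minus_distrib_mat[OF R R K] mult_minus_distrib_mat[OF K R K]
    by simp
  also have "\<dots> = ?R * ?R - K"
    using Suc assms(5) K RR by (intro eq_matI) auto
  finally have "repeated_square (S - K) (Suc j) = repeated_square S (Suc j) - K" by simp
  moreover have "?R * ?R * K = K" using assoc_mult_mat[OF R R K] Suc by simp
  moreover have "K * (?R * ?R) = K" using assoc_mult_mat[OF K R R] Suc by simp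
  ultimately show ?case by simp
qed (use assms in simp)

text \<open>Taking roots of order 2^j makes the constant factor c irrelevant; below it is the
  dimension n, which must not enter the entry bound.\<close>

lemma le_of_all_power2_le:
  fixes b \<beta> c :: real
  assumes "0 < \<beta>" "\<And>j. b ^ (2 ^ Suc j) \<le> c * \<beta> ^ (2 ^ Suc j)"
  shows "b \<le> \<beta>"
proof (rule ccontr)
  assume "\<not> b \<le> \<beta>"
  then have q: "1 < b / \<beta>" using assms(1) by simp
  then obtain j where "c < (b / \<beta>) ^ j" using real_arch_pow by blast
  also have "\<dots> \<le> (b / \<beta>) ^ (2 ^ Suc j)"
    using q less_exp[of "Suc j"] by (intro power_increasing) auto
  also have "\<dots> \<le> c"
    using assms(2)[of j] assms(1) by (simp add: power_divide pos_divide_le_eq)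
  finally show False by simp
qed

text \<open>With \<open>R = nb_mat d k A\<close> and \<open>K\<close> the averaging matrix, \<open>R - K\<close> is symmetric, so each of its
  entries raised to the power \<open>2 ^ j\<close> is at most the trace of its \<open>2 ^ j\<close>-th power, which only involves
  the non-trivial eigenvalues. Letting \<open>j\<close> tend to infinity replaces the spectral theorem.\<close>

lemma nb_mat_entry_bound:
  fixes A :: "real mat"
  assumes A: "A \<in> carrier_mat n n" "transpose_mat A = A"
    and rows: "\<And>i. i < n \<Longrightarrow> (\<Sum>j<n. A $$ (i, j)) = real d"
    and ls: "char_poly A = (\<Prod>a\<leftarrow>ls. [:- a, 1:])" "ls ! 0 = real d"
    and \<beta>: "0 < \<beta>" "\<And>i. 1 \<le> i \<Longrightarrow> i < n \<Longrightarrow> \<bar>nb_poly d k (ls ! i)\<bar> \<le> \<beta>"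
    and d: "2 \<le> d" and uv: "u < n" "v < n"
  shows "\<bar>nb_mat d k A $$ (u, v) - 1 / real n\<bar> \<le> \<beta>"
proof -
  define R where "R = nb_mat d k A"
  define K where "K = mat n n (\<lambda>_. 1 / real n)"
  have n: "0 < n" using uv by simp
  have K: "K \<in> carrier_mat n n" and R: "R \<in> carrier_mat n n"
    using nb_mat_carrier[OF A(1)] by (auto simp: K_def R_def)
  have AK: "A * K = real d \<cdot>\<^sub>m K"
  proof (rule eq_matI)
    fix i j assume "i < dim_row (real d \<cdot>\<^sub>m K)" "j < dim_col (real d \<cdot>\<^sub>m K)"
    then have ij: "i < n" "j < n" by (auto simp: K_def)
    have "(A * K) $$ (i, j) = (\<Sum>k<n. A $$ (i, k)) * (1 / real n)"
      unfolding index_mult_mat_sum[OF A(1) K ij] sum_distrib_right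
      by (rule sum.cong) (use ij in \<open>auto simp: K_def\<close>)
    then show "(A * K) $$ (i, j) = (real d \<cdot>\<^sub>m K) $$ (i, j)"
      using ij rows by (simp add: K_def)
  qed (use A K in auto)
  have KK: "K * K = K"
  proof (rule eq_matI)
    fix i j assume "i < dim_row K" "j < dim_col K"
    then have ij: "i < n" "j < n" by (auto simp: K_def)
    have "(K * K) $$ (i, j) = (\<Sum>k<n. 1 / real n * (1 / real n))"
      unfolding index_mult_mat_sum[OF K K ij] by (rule sum.cong) (use ij in \<open>auto simp: K_def\<close>)
    then show "(K * K) $$ (i, j) = K $$ (i, j)" using ij n by (simp add: K_def)
  qed (use K in auto)
  have KT: "transpose_mat K = K" by (rule eq_matI) (auto simp: K_def)
  have RT: "transpose_mat R = R" using nb_mat_symmetric[OF A] by (simp add: R_def)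
  have RK: "R * K = K" unfolding R_def by (rule nb_mat_fix[OF A(1) K AK d])
  have KR: "K * R = K"
    using transpose_mult[OF R K] RK KT RT by simp
  \<comment> \<open>The Schur form carries ls on its diagonal in the given order, so index 0 belongs
    to the eigenvalue d.\<close>
  obtain B P Q where BPQ: "schur_decomposition A ls = (B, P, Q)" by (metis prod_cases3)
  from schur_decomposition[OF A(1) ls(1) BPQ]
  have sim: "similar_mat_wit A B P Q" and ut: "upper_triangular B" and diag: "diag_mat B = ls" by auto
  have c: "B \<in> carrier_mat n n" "P \<in> carrier_mat n n" "Q \<in> carrier_mat n n"
    "P * Q = 1\<^sub>m n" "Q * P = 1\<^sub>m n" "A = P * B * Q"
    using sim A(1) by (auto simp: similar_mat_wit_def Let_def)
  interpret triangularisation n P Q by unfold_locales (use c in auto)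
  have "B $$ (i, i) = ls ! i" if "i < n" for i
    using that c(1) by (simp add: diag[symmetric] diag_mat_def)
  then have "tri A (\<lambda>i. ls ! i)" using c ut by (intro triI[of B]) auto
  then have "tri R (\<lambda>i. nb_poly d k (ls ! i))"
    unfolding R_def by (rule tri_nb_mat[OF triangularisation_axioms])
  then have tri_sq: "tri (repeated_square R j) (\<lambda>i. nb_poly d k (ls ! i) ^ 2 ^ j)" for j
  proof (induction j)
    case (Suc j)
    show ?case using tri_mult[OF Suc.IH[OF Suc.prems] Suc.IH[OF Suc.prems]]
      by (simp add: power_add[symmetric] mult_2)
  qed simp
  let ?B = "R - K"
  have B: "?B \<in> carrier_mat n n" "transpose_mat ?B = ?B"
    using R K RT KT transpose_minus[of R n n K] by auto
  have "\<bar>?B $$ (u, v)\<bar> ^ (2 ^ Suc j) \<le> real n * \<beta> ^ (2 ^ Suc j)" for j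
  proof -
    let ?e = "2 ^ Suc j :: nat"
    have "\<bar>?B $$ (u, v)\<bar> ^ ?e \<le> mat_trace (repeated_square ?B (Suc j))"
      by (rule entry_power_le_trace[OF B uv])
    also have "\<dots> = mat_trace (repeated_square R (Suc j) - K)"
      using repeated_square_minus[OF R K RK KR KK] by metis
    also have "\<dots> = mat_trace (repeated_square R (Suc j)) - mat_trace K"
      using repeated_square_carrier[OF R, of "Suc j"] K
      by (simp add: mat_trace_def sum_subtractf del: repeated_square.simps)
    \<comment> \<open>This 1 cancels the contribution of index 0, leaving only the indices
      controlled by \<beta>.\<close>
    also have "mat_trace K = 1" using n by (simp add: mat_trace_def K_def)
    also have "mat_trace (repeated_square R (Suc j)) = (\<Sum>i<n. nb_poly d k (ls ! i) ^ ?e)"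
      by (rule tri_trace[OF tri_sq])
    also have "\<dots> = 1 + (\<Sum>i\<in>{..<n} - {0}. nb_poly d k (ls ! i) ^ ?e)"
      using n by (subst sum.remove[of _ 0]) (auto simp: ls(2) nb_poly_degree[OF d])
    also have "(\<Sum>i\<in>{..<n} - {0}. nb_poly d k (ls ! i) ^ ?e) \<le> (\<Sum>i\<in>{..<n} - {0}. \<beta> ^ ?e)"
    proof (rule sum_mono)
      fix i assume "i \<in> {..<n} - {0}"
      then have "\<bar>nb_poly d k (ls ! i)\<bar> ^ ?e \<le> \<beta> ^ ?e" by (intro power_mono \<beta>(2)) auto
      then show "nb_poly d k (ls ! i) ^ ?e \<le> \<beta> ^ ?e" by (simp add: power_even_abs)
    qed
    also have "\<dots> \<le> (\<Sum>i<n. \<beta> ^ ?e)"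
      using \<beta>(1) by (intro sum_mono2) auto
    finally show ?thesis by simp
  qed
  then have "\<bar>?B $$ (u, v)\<bar> \<le> \<beta>" by (rule le_of_all_power2_le[OF \<beta>(1)])
  then show ?thesis using uv R K by (simp add: R_def K_def)
qed

section \<open>Mixing\<close>

context nb_regular begin

lemma sum_adj_matrix:
  assumes vs: "distinct vs" "set vs = pverts G" and i: "i < length vs"
  shows "(\<Sum>k<length vs. adj_matrix G vs $$ (i, k) * f (vs ! k)) = (\<Sum>w\<in>neighbours G (vs ! i). f w)"
proof -
  have "(\<Sum>k<length vs. adj_matrix G vs $$ (i, k) * f (vs ! k)) =
      (\<Sum>k<length vs. if vs ! k \<in> neighbours G (vs ! i) then f (vs ! k) else 0)"
    by (rule sum.cong) (use i in \<open>auto simp: adj_matrix_def neighbours_iff\<close>)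
  also have "\<dots> = (\<Sum>w\<in>pverts G. if w \<in> neighbours G (vs ! i) then f w else 0)"
    by (rule sum.reindex_bij_betw) (use bij_betw_nth[OF vs(1), of "{..<length vs}" "pverts G"] vs(2) in simp)
  also have "\<dots> = (\<Sum>w\<in>pverts G \<inter> neighbours G (vs ! i). f w)"
    using pair_finite_verts by (simp add: sum.inter_restrict)
  also have "pverts G \<inter> neighbours G (vs ! i) = neighbours G (vs ! i)"
    using neighbours_sub by blast
  finally show ?thesis .
qed

text \<open>Both sides obey the same three-term recursion, since multiplication by the adjacency
  matrix is summation over neighbours.\<close>

lemma nb_vertex_prob_mat:
  assumes vs: "distinct vs" "set vs = pverts G" and ij: "i < length vs" "j < length vs"
  shows "nb_mat d k (adj_matrix G vs) $$ (i, j) = nb_vertex_prob G (vs ! j) k (vs ! i)"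
  using ij
proof (induction k arbitrary: i j rule: induct_nat_012)
  case 0
  then show ?case using vs(1) by (simp add: adj_matrix_def nth_eq_iff_index_eq)
next
  case 1
  have v: "vs ! i \<in> pverts G" using nth_mem[OF 1(1)] vs(2) by simp
  have "(\<Sum>w\<in>neighbours G (vs ! i). of_bool (w = vs ! j)) = (of_bool (vs ! j \<in> neighbours G (vs ! i)) :: real)"
    by (simp add: of_bool_def sum.delta)
  then show ?case
    using 1 v by (simp add: vertex_recursion_1 neighbours_iff adj_matrix_def del: nb_vertex_prob.simps(2))
next
  case (ge2 k)
  let ?A = "adj_matrix G vs" and ?n = "length vs"
  have v: "vs ! i \<in> pverts G" using nth_mem[OF ge2(3)] vs(2) by simp
  have A: "?A \<in> carrier_mat ?n ?n" by (simp add: adj_matrix_def)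
  note c = nb_mat_carrier[OF A]
  have "(?A * nb_mat d (Suc k) ?A) $$ (i, j) =
      (\<Sum>l<?n. ?A $$ (i, l) * nb_vertex_prob G (vs ! j) (Suc k) (vs ! l))"
    unfolding index_mult_mat_sum[OF A c ge2(3,4)]
    by (rule sum.cong[OF refl]) (simp only: lessThan_iff ge2(2)[OF _ ge2(4)])
  also have "\<dots> = (\<Sum>w\<in>neighbours G (vs ! i). nb_vertex_prob G (vs ! j) (Suc k) w)"
    by (rule sum_adj_matrix[OF vs ge2(3)])
  finally have 1: "(?A * nb_mat d (Suc k) ?A) $$ (i, j) =
    (\<Sum>w\<in>neighbours G (vs ! i). nb_vertex_prob G (vs ! j) (Suc k) w)" .
  have "nb_mat d (Suc (Suc k)) ?A $$ (i, j) =
      ((?A * nb_mat d (Suc k) ?A) $$ (i, j) - nb_mat d k ?A $$ (i, j)) / real (d - 1)"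
    using A c[of d "Suc k"] c[of d k] ge2(3,4) by (simp del: index_mult_mat(1))
  then show ?case
    by (simp only: 1 ge2(1)[OF ge2(3,4)] vertex_recursion[OF v])
qed

lemma vertex_mixing:
  assumes n: "card (pverts G) = n" and ls: "adj_eigenvalues G ls" "ls ! 0 = real d"
    and \<beta>: "0 < \<beta>" "\<And>i. 1 \<le> i \<Longrightarrow> i < n \<Longrightarrow> \<bar>nb_poly d k (ls ! i)\<bar> \<le> \<beta>"
    and uv: "u \<in> pverts G" "v \<in> pverts G"
  shows "\<bar>nb_vertex_prob G v k u - 1 / real n\<bar> \<le> \<beta>"
proof -
  obtain vs where vs: "distinct vs" "set vs = pverts G"
    and char: "char_poly (adj_matrix G vs) = (\<Prod>a\<leftarrow>ls. [:- a, 1:])"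
    using ls(1) by (auto simp: adj_eigenvalues_def)
  have len: "length vs = n" using n vs distinct_card by metis
  from uv(1) obtain i where i: "i < n" "u = vs ! i"
    unfolding vs(2)[symmetric] in_set_conv_nth len by auto
  from uv(2) obtain j where j: "j < n" "v = vs ! j"
    unfolding vs(2)[symmetric] in_set_conv_nth len by auto
  note ij = i j
  let ?A = "adj_matrix G vs"
  have "\<bar>nb_mat d k ?A $$ (i, j) - 1 / real n\<bar> \<le> \<beta>"
  proof (rule nb_mat_entry_bound[OF _ _ _ char ls(2) \<beta>(1) \<beta>(2)])
    show "?A \<in> carrier_mat n n" by (simp add: adj_matrix_def len)
    show "transpose_mat ?A = ?A"
    proof (rule eq_matI)
      fix i j assume "i < dim_row ?A" "j < dim_col ?A"
      moreover have "(vs ! i, vs ! j) \<in> parcs G \<longleftrightarrow> (vs ! j, vs ! i) \<in> parcs G"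
        using parcs_sym by blast
      ultimately show "transpose_mat ?A $$ (i, j) = ?A $$ (i, j)"
        by (simp add: adj_matrix_def)
    qed (simp_all add: adj_matrix_def)
    show "(\<Sum>j<n. ?A $$ (i, j)) = real d" if "i < n" for i
    proof -
      have v: "vs ! i \<in> pverts G" using nth_mem[of i vs] that vs(2) len by simp
      show ?thesis using sum_adj_matrix[OF vs, of i "\<lambda>_. 1"] that card_neighbours[OF v] len by simp
    qed
  qed (use d3 ij in auto)
  then show ?thesis using nb_vertex_prob_mat[OF vs, of i j k] ij len by simp
qed

text \<open>By \<open>arc_recursion\<close>, d - 1 times the new arc deviation is d times a vertex
  deviation minus the old arc deviation. With D = d - 1, the induction with constant 5 needs D + 1 +
  (4 / 3) * 5 \<le> 5 D, which holds for D \<ge> 2; the factor 4 / 3 is the price of raising the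
  exponent.\<close>

lemma arc_mixing:
  assumes C: "1 \<le> C" and \<rho>: "3 / 4 \<le> \<rho>" and n: "card (pverts G) = n"
    and r: "\<And>k u. u \<in> pverts G \<Longrightarrow> \<bar>nb_vertex_prob G v k u - 1 / real n\<bar> \<le> C * \<rho> ^ k"
    and "(a, b) \<in> parcs G"
  shows "\<bar>nb_arc_prob G v k a b - 1 / real n\<bar> \<le> 5 * C * \<rho> ^ k"
  using assms(5)
proof (induction k arbitrary: a b)
  case 0
  have "1 / real n \<le> 1" by (cases n) auto
  then have "\<bar>of_bool (b = v) - 1 / real n\<bar> \<le> 1" by auto
  then show ?case using C by simp
next
  case (Suc k)
  let ?D = "real (d - 1)" and ?x = "1 / real n"
  have D: "2 \<le> ?D" "real d = ?D + 1" using d3 by (auto simp: of_nat_diff)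
  have eq: "?D * (nb_arc_prob G v (Suc k) a b - ?x) =
      real d * (nb_vertex_prob G v (Suc k) b - ?x) - (nb_arc_prob G v k b a - ?x)"
    unfolding right_diff_distrib arc_recursion[OF Suc.prems] D(2) by (simp add: algebra_simps)
  have "?D * \<bar>nb_arc_prob G v (Suc k) a b - ?x\<bar> = \<bar>?D * (nb_arc_prob G v (Suc k) a b - ?x)\<bar>"
    using D(1) by (simp only: abs_mult abs_of_nat)
  also have "\<dots> = \<bar>real d * (nb_vertex_prob G v (Suc k) b - ?x) - (nb_arc_prob G v k b a - ?x)\<bar>"
    by (simp only: eq)
  also have "\<dots> \<le> real d * (C * \<rho> ^ Suc k) + 5 * C * \<rho> ^ k"
  proof (rule order_trans[OF abs_triangle_ineq4 add_mono])
    show "\<bar>real d * (nb_vertex_prob G v (Suc k) b - ?x)\<bar> \<le> real d * (C * \<rho> ^ Suc k)"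
      unfolding abs_mult using r[of b "Suc k"] parcs_verts[OF Suc.prems]
      by (intro mult_mono) (auto simp del: nb_vertex_prob.simps)
    show "\<bar>nb_arc_prob G v k b a - ?x\<bar> \<le> 5 * C * \<rho> ^ k"
      by (rule Suc.IH[OF parcs_sym[OF Suc.prems]])
  qed
  also have "\<dots> \<le> real d * (C * \<rho> ^ Suc k) + 20 / 3 * (C * \<rho> ^ Suc k)"
  proof -
    have "C * \<rho> ^ k * 1 \<le> C * \<rho> ^ k * (4 / 3 * \<rho>)" using C \<rho> by (intro mult_left_mono) auto
    then show ?thesis by (simp add: mult_ac)
  qed
  also have "\<dots> = (?D + 23 / 3) * (C * \<rho> ^ Suc k)"
    unfolding D(2) by (simp add: ring_distribs)
  also have "\<dots> \<le> (?D * 5) * (C * \<rho> ^ Suc k)"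
    using D(1) C \<rho> by (intro mult_right_mono) auto
  finally have "?D * \<bar>nb_arc_prob G v (Suc k) a b - ?x\<bar> \<le> ?D * (5 * C * \<rho> ^ Suc k)"
    by (simp only: mult_ac)
  moreover have "0 < ?D" using D(1) by linarith
  ultimately show ?case by (simp only: mult_le_cancel_left_pos)
qed

end

lemma ndl_graph_nb_regular:
  assumes "ndl_graph n d lam G" "3 \<le> d"
  shows "nb_regular G d"
  using assms by (auto simp: ndl_graph_def nb_regular_def nb_regular_axioms_def)

text \<open>The constants are fixed before the graph, so the estimate is uniform in n and in the
  history. Histories with a previous vertex use \<open>arc_mixing\<close>, single vertices
  \<open>vertex_mixing\<close>.\<close>

lemma ndl_mixing:
  fixes lam :: real
  assumes "3 \<le> d" "lam < real d"
  obtains C \<rho> where "0 < C" "0 < \<rho>" "\<rho> < 1"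
    "\<And>n (G :: 'v pair_pre_digraph) ws v k. ndl_graph n d lam G \<Longrightarrow> nb_list G ws \<Longrightarrow> v \<in> pverts G \<Longrightarrow>
      \<bar>measure_pmf.prob (kiter (nb_step G) k ws) {ws. last ws = v} - 1 / real n\<bar> \<le> C * \<rho> ^ k"
proof -
  obtain C \<rho> where C: "1 \<le> C" "3 / 4 \<le> \<rho>" "\<rho> < 1"
    and bound: "\<And>x k. \<bar>x\<bar> \<le> lam \<Longrightarrow> \<bar>nb_poly d k x\<bar> \<le> C * \<rho> ^ k"
    using nb_poly_geometric_bound[OF assms] by metis
  show ?thesis
  proof (rule that[of "5 * C" \<rho>])
    fix n :: nat and G :: "'v pair_pre_digraph" and ws v k
    assume G: "ndl_graph n d lam G" and ws: "nb_list G ws" and v: "v \<in> pverts G"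
    interpret nb_regular G d by (rule ndl_graph_nb_regular[OF G assms(1)])
    from G obtain ls where n: "card (pverts G) = n" and ls: "adj_eigenvalues G ls" "ls ! 0 = real d"
      and lam: "Max {\<bar>ls ! i\<bar> | i. 1 \<le> i \<and> i < n} = lam"
      by (auto simp: ndl_graph_def)
    have "\<bar>ls ! i\<bar> \<le> lam" if "1 \<le> i" "i < n" for i
      unfolding lam[symmetric] by (rule Max_ge) (use that in auto)
    then have r: "\<bar>nb_vertex_prob G v k u - 1 / real n\<bar> \<le> C * \<rho> ^ k" if "u \<in> pverts G" for k u
      by (intro vertex_mixing[OF n ls _ _ that v]) (use C bound in auto)
    show "\<bar>measure_pmf.prob (kiter (nb_step G) k ws) {ws. last ws = v} - 1 / real n\<bar> \<le> 5 * C * \<rho> ^ k"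
    proof (cases "2 \<le> length ws")
      case True
      then show ?thesis
        unfolding prob_last_arc[OF ws True]
        by (intro arc_mixing[OF C(1,2) n r] nb_list_prev_arc[OF ws])
    next
      case False
      have "ws \<noteq> []" using ws by (simp add: nb_list_def)
      with False obtain u where "ws = [u]" by (cases ws) (auto simp: Suc_le_eq)
      moreover from this have "u \<in> pverts G" using ws by (simp add: nb_list_def)
      moreover have "C * \<rho> ^ k \<le> 5 * C * \<rho> ^ k" using C by simp
      ultimately show ?thesis using r[of u k] prob_last_vertex[of u k v] by simp
    qed
  qed (use C in auto)
qed

section \<open>Girth and distances\<close>

context nb_regular begin

lemma nb_list_awalk:
  assumes "nb_list G ws" "i \<le> j" "j < length ws"
  shows "awalk (ws ! i) (map (\<lambda>k. (ws ! k, ws ! Suc k)) [i..<j]) (ws ! j)"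
  using assms(2)
proof (induction i rule: inc_induct)
  case base
  have "ws ! j \<in> pverts G" using assms by (auto simp: nb_list_def)
  then show ?case by (simp add: awalk_Nil_iff)
next
  case (step i)
  have "(ws ! i, ws ! Suc i) \<in> parcs G" using assms(1,3) step.hyps by (simp add: nb_list_def)
  then show ?case using step by (simp add: upt_conv_Cons awalk_Cons_iff)
qed

lemma graph_dist_le:
  assumes "nb_list G ws" "i \<le> j" "j < length ws"
  shows "graph_dist G (ws ! i) (ws ! j) \<le> ereal (real (j - i))"
proof -
  have "awalk_cost (\<lambda>_. 1) p = real (length p)" for p
    by (induction p) auto
  then show ?thesis
    using min_cost_le_walk_cost[OF nb_list_awalk[OF assms], of "\<lambda>_. 1"] by (simp add: graph_dist_def)
qed

text \<open>Shrink the closed segment while a vertex repeats after position i; once none does, the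
  segment is a cycle.\<close>

lemma girth_le:
  assumes ws: "nb_list G ws" and "i < j" "j < length ws" "ws ! i = ws ! j"
  shows "girth G \<le> ereal (real (j - i))"
  using assms(2-4)
proof (induction "j - i" arbitrary: i j rule: less_induct)
  case less
  show ?case
  proof (cases "\<exists>i' j'. i < i' \<and> i' < j' \<and> j' \<le> j \<and> ws ! i' = ws ! j'")
    case True
    then obtain i' j' where "i < i'" "i' < j'" "j' \<le> j" "ws ! i' = ws ! j'" by blast
    with less.hyps[of j' i'] less.prems have "girth G \<le> ereal (real (j' - i'))" by auto
    also have "\<dots> \<le> ereal (real (j - i))" using \<open>i < i'\<close> \<open>j' \<le> j\<close> by simp
    finally show ?thesis .
  next
    case False
    let ?p = "map (\<lambda>k. (ws ! k, ws ! Suc k)) [i..<j]"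
    have walk: "awalk (ws ! i) ?p (ws ! i)"
      using nb_list_awalk[OF ws, of i j] less.prems by simp
    \<comment> \<open>Length 1 would be a loop and length 2 a step back; this is where
      non-backtracking yields a genuine cycle.\<close>
    have "j \<noteq> Suc i"
    proof
      assume "j = Suc i"
      then have "(ws ! i, ws ! i) \<in> parcs G" using ws less.prems by (auto simp: nb_list_def)
      then show False using pair_no_loops by fastforce
    qed
    moreover have "j \<noteq> Suc (Suc i)"
      using ws less.prems by (auto simp: nb_list_def)
    ultimately have len: "3 \<le> length ?p" using less.prems by simp
    have "tl (awalk_verts (ws ! i) ?p) = map (\<lambda>k. ws ! Suc k) [i..<j]"
      using walk awalk_verts_conv'[of "ws ! i" ?p "ws ! i"] len by (auto simp: awalk_def)
    moreover have "distinct (map (\<lambda>k. ws ! Suc k) [i..<j])"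
    proof -
      have "inj_on (\<lambda>k. ws ! Suc k) {i..<j}"
        by (rule linorder_inj_onI) (use False in \<open>auto simp: Suc_le_eq\<close>)
      then show ?thesis by (simp add: distinct_map)
    qed
    ultimately have "cycle ?p" unfolding cycle_def using walk len by (intro exI[of _ "ws ! i"]) auto
    then have "girth G \<le> ereal (real (length ?p))"
      unfolding girth_def using len by (intro INF_lower) auto
    then show ?thesis by simp
  qed
qed

lemma take_kiter_nb_step:
  "ws' \<in> set_pmf (kiter (nb_step G) m ws) \<Longrightarrow> take (length ws) ws' = ws"
proof (induction m arbitrary: ws)
  case (Suc m)
  from Suc.prems obtain w where "ws' \<in> set_pmf (kiter (nb_step G) m (ws @ [w]))"
    by (auto simp: nb_step_def[of G ws])
  then have "take (length (ws @ [w])) ws' = ws @ [w]" by (rule Suc.IH)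
  then have "take (length ws) (take (length (ws @ [w])) ws') = ws" by simp
  then show ?case by (simp add: min_def)
qed simp

text \<open>A return to the current vertex within k steps would bound the girth by k, and reaching
  another v would bound the distance by k.\<close>

lemma no_early_hit:
  assumes ws: "nb_list G ws" and k: "0 < k" "real k < g"
    and girth: "ereal g \<le> girth G"
    and dist: "v \<noteq> last ws \<Longrightarrow> ereal g \<le> graph_dist G (last ws) v"
  shows "measure_pmf.prob (kiter (nb_step G) k ws) {ws. last ws = v} = 0"
proof -
  have "last ws' \<noteq> v" if ws': "ws' \<in> set_pmf (kiter (nb_step G) k ws)" for ws'
  proof
    assume v: "last ws' = v"
    have nb: "nb_list G ws'"
      using set_kiter[of "Collect (nb_list G)" "nb_step G" ws k, OF nb_step_closed] ws ws' by auto
    have len: "length ws' = length ws + k" by (rule length_kiter_nb_step[OF ws'])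
    have ne: "ws \<noteq> []" using ws by (simp add: nb_list_def)
    let ?i = "length ws - 1" and ?j = "length ws' - 1"
    have "0 < length ws" using ne by simp
    then have ij: "?i < ?j" "?j < length ws'" "?j - ?i = k" using len k by linarith+
    have wi: "ws' ! ?i = last ws"
      using take_kiter_nb_step[OF ws'] ne nth_take[of ?i "length ws" ws'] by (simp add: last_conv_nth)
    have "ws' \<noteq> []" using len ne by auto
    then have wj: "ws' ! ?j = v" using v by (simp add: last_conv_nth)
    show False
    proof (cases "v = last ws")
      case True
      then have "girth G \<le> ereal (real k)" using girth_le[OF nb ij(1,2)] wi wj ij(3) by simp
      then have "ereal g \<le> ereal (real k)" using girth by (rule order_trans[rotated])
      then show False using k(2) by simp
    next
      case False
      have "graph_dist G (last ws) v \<le> ereal (real k)"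
        using graph_dist_le[OF nb less_imp_le[OF ij(1)] ij(2)] by (simp only: ij(3) wi wj)
      then have "ereal g \<le> ereal (real k)" using dist[OF False] by (rule order_trans[rotated])
      then show False using k(2) by simp
    qed
  qed
  then show ?thesis by (auto simp: measure_pmf_zero_iff)
qed

end

section \<open>Convergence in distribution\<close>

lemma pmf_finite_approx:
  assumes "0 < (\<delta>::real)"
  obtains A where "finite A" "1 - \<delta> < measure_pmf.prob Q A"
proof -
  let ?A = "\<lambda>n. from_nat_into (set_pmf Q) ` {..n::nat}"
  have "(\<lambda>n. measure_pmf.prob Q (?A n)) \<longlonglongrightarrow> measure_pmf.prob Q (\<Union>n. ?A n)"
    by (rule measure_pmf.finite_Lim_measure_incseq) (auto simp: incseq_def)
  also have "(\<Union>n. ?A n) = range (from_nat_into (set_pmf Q))" by auto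
  also have "\<dots> = set_pmf Q" by (rule range_from_nat_into[OF set_pmf_not_empty countable_set_pmf])
  also have "measure_pmf.prob Q (set_pmf Q) = 1" by (simp add: measure_pmf.prob_eq_1 AE_measure_pmf)
  finally have "eventually (\<lambda>n. 1 - \<delta> < measure_pmf.prob Q (?A n)) sequentially"
    by (rule order_tendstoD) (use assms in simp)
  then obtain n where "1 - \<delta> < measure_pmf.prob Q (?A n)" by (auto simp: eventually_sequentially)
  then show ?thesis by (rule that[rotated]) simp
qed

lemma pmf_expectation_truncate:
  fixes f :: "'a \<Rightarrow> real"
  assumes A: "finite A" and B: "\<And>x. \<bar>f x\<bar> \<le> B"
  shows "\<bar>measure_pmf.expectation P f - (\<Sum>x\<in>A. f x * pmf P x)\<bar> \<le> B * (1 - (\<Sum>x\<in>A. pmf P x))"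
proof -
  have B0: "0 \<le> B" using B[of undefined] by linarith
  have bd: "\<bar>f x * of_bool (x \<in> A)\<bar> \<le> B" "\<bar>f x * of_bool (x \<notin> A)\<bar> \<le> B" for x
    using B[of x] B0 by auto
  have "measure_pmf.expectation P f =
      measure_pmf.expectation P (\<lambda>x. f x * of_bool (x \<in> A) + f x * of_bool (x \<notin> A))"
    by (rule Bochner_Integration.integral_cong) auto
  also have "\<dots> = measure_pmf.expectation P (\<lambda>x. f x * of_bool (x \<in> A)) +
      measure_pmf.expectation P (\<lambda>x. f x * of_bool (x \<notin> A))"
    by (rule Bochner_Integration.integral_add; rule pmf_integrable_bounded; rule bd)
  also have "measure_pmf.expectation P (\<lambda>x. f x * of_bool (x \<in> A)) = (\<Sum>x\<in>A. f x * pmf P x)"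
    by (subst integral_measure_pmf_real[OF A]) auto
  finally have "\<bar>measure_pmf.expectation P f - (\<Sum>x\<in>A. f x * pmf P x)\<bar> =
      \<bar>measure_pmf.expectation P (\<lambda>x. f x * of_bool (x \<notin> A))\<bar>" by simp
  also have "\<dots> \<le> measure_pmf.expectation P (\<lambda>x. \<bar>f x * of_bool (x \<notin> A)\<bar>)"
    by (rule integral_abs_bound)
  also have "\<dots> \<le> measure_pmf.expectation P (\<lambda>x. B * indicator (- A) x)"
  proof (rule integral_mono)
    show "integrable (measure_pmf P) (\<lambda>x. \<bar>f x * of_bool (x \<notin> A)\<bar>)"
      by (rule pmf_integrable_bounded[where B = B]) (use bd(2) in simp)
    show "integrable (measure_pmf P) (\<lambda>x. B * indicator (- A) x)"
      by (rule pmf_integrable_bounded[where B = B]) (use B0 in \<open>auto simp: indicator_def\<close>)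
    show "\<bar>f x * of_bool (x \<notin> A)\<bar> \<le> B * indicator (- A) x" for x
      using B[of x] by (auto simp: indicator_def)
  qed
  also have "\<dots> = B * measure_pmf.prob P (- A)" by simp
  also have "measure_pmf.prob P (- A) = 1 - measure_pmf.prob P A"
    using measure_pmf.prob_compl[of A P] by (simp add: Compl_eq_Diff_UNIV)
  also have "measure_pmf.prob P A = (\<Sum>x\<in>A. pmf P x)" by (rule measure_measure_pmf_finite[OF A])
  finally show ?thesis .
qed

text \<open>No mass escapes because the limit is itself a probability: on a finite set carrying
  almost all of Q the masses of the \<open>P i\<close> converge to that of Q, so their tails are
  small too.\<close>

lemma pmf_tendsto_expectation:
  fixes f :: "'a \<Rightarrow> real"
  assumes lim: "\<And>x. ((\<lambda>i. pmf (P i) x) \<longlongrightarrow> pmf Q x) F" and B: "\<And>x. \<bar>f x\<bar> \<le> B"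
  shows "((\<lambda>i. measure_pmf.expectation (P i) f) \<longlongrightarrow> measure_pmf.expectation Q f) F"
proof (rule tendstoI)
  fix e :: real assume e: "0 < e"
  have B0: "0 \<le> B" using B[of undefined] by linarith
  \<comment> \<open>Two tails, one of \<open>P i\<close> and one of Q, cost B each; the 1 keeps the
    quotient meaningful for B = 0.\<close>
  have "0 < e / (2 * B + 1)" using e B0 by simp
  then obtain A where A: "finite A" "1 - e / (2 * B + 1) < measure_pmf.prob Q A"
    by (rule pmf_finite_approx)
  define a where "a p = (\<Sum>x\<in>A. pmf p x)" for p
  define s where "s p = (\<Sum>x\<in>A. f x * pmf p x)" for p
  have small: "B * (1 - a Q) + B * (1 - a Q) < e"
  proof -
    have "1 - a Q < e / (2 * B + 1)" using A by (simp add: a_def measure_measure_pmf_finite)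
    then have "2 * B * (1 - a Q) \<le> 2 * B * (e / (2 * B + 1))" using B0 by (intro mult_left_mono) auto
    also have "\<dots> < e" using e B0 by (simp add: field_simps)
    finally show ?thesis by simp
  qed
  have "((\<lambda>i. a (P i)) \<longlongrightarrow> a Q) F" "((\<lambda>i. s (P i)) \<longlongrightarrow> s Q) F"
    unfolding a_def s_def by (intro tendsto_intros lim)+
  then have "((\<lambda>i. B * (1 - a (P i)) + B * (1 - a Q) + \<bar>s (P i) - s Q\<bar>) \<longlongrightarrow>
      B * (1 - a Q) + B * (1 - a Q) + \<bar>s Q - s Q\<bar>) F"
    by (intro tendsto_intros)
  then have "eventually (\<lambda>i. B * (1 - a (P i)) + B * (1 - a Q) + \<bar>s (P i) - s Q\<bar> < e) F"
    by (rule order_tendstoD) (use small in simp)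
  then show "eventually (\<lambda>i. dist (measure_pmf.expectation (P i) f) (measure_pmf.expectation Q f) < e) F"
  proof eventually_elim
    case (elim i)
    have "\<bar>measure_pmf.expectation p f - s p\<bar> \<le> B * (1 - a p)" for p
      unfolding s_def a_def by (rule pmf_expectation_truncate[OF A(1) B])
    from this[of "P i"] this[of Q] elim show ?case by (simp add: dist_real_def)
  qed
qed

text \<open>The vector takes countably many values, so singletons determine its law and independence
  factorises them. The default 0 of \<open>Pi_pmf\<close> is never taken, as the index set is
  \<open>UNIV\<close>.\<close>

lemma distr_indep_poisson:
  fixes Z :: "'r::finite \<Rightarrow> 'w \<Rightarrow> nat"
  assumes "prob_space M" and ind: "prob_space.indep_vars M (\<lambda>_. count_space UNIV) Z UNIV"
    and law: "\<And>i. distr M (count_space UNIV) (Z i) = measure_pmf p"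
  shows "(\<lambda>\<omega> i. Z i \<omega>) \<in> measurable M (count_space UNIV)"
    and "distr M (count_space UNIV) (\<lambda>\<omega> i. Z i \<omega>) = measure_pmf (Pi_pmf UNIV 0 (\<lambda>_. p))"
proof -
  interpret prob_space M by fact
  have Z: "Z i \<in> measurable M (count_space UNIV)" for i
    using ind by (simp add: indep_vars_def)
  have pre: "(\<lambda>\<omega> i. Z i \<omega>) -` {x} \<inter> space M = (\<Inter>i\<in>UNIV. Z i -` {x i} \<inter> space M)" for x
    by (auto simp: fun_eq_iff)
  have c: "countable (UNIV :: ('r \<Rightarrow> nat) set)" by (rule countableI_type)
  show m: "(\<lambda>\<omega> i. Z i \<omega>) \<in> measurable M (count_space UNIV)"
    unfolding measurable_count_space_eq_countable[OF c]
  proof (intro conjI ballI)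
    show "(\<lambda>\<omega> i. Z i \<omega>) -` {x} \<inter> space M \<in> sets M" for x
      unfolding pre by (rule sets.finite_INT) (use measurable_sets[OF Z] in auto)
  qed simp
  show "distr M (count_space UNIV) (\<lambda>\<omega> i. Z i \<omega>) = measure_pmf (Pi_pmf UNIV 0 (\<lambda>_. p))"
  proof (rule measure_eqI_countable[where A = UNIV])
    fix x :: "'r \<Rightarrow> nat"
    have one: "prob (Z i -` {x i} \<inter> space M) = pmf p (x i)" for i
      using measure_distr[OF Z, of "{x i}" i] by (simp add: law measure_pmf_single)
    have "emeasure (distr M (count_space UNIV) (\<lambda>\<omega> i. Z i \<omega>)) {x} = prob (\<Inter>i\<in>UNIV. Z i -` {x i} \<inter> space M)"
      by (subst emeasure_distr[OF m]) (auto simp: pre emeasure_eq_measure)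
    also have "prob (\<Inter>i\<in>UNIV. Z i -` {x i} \<inter> space M) = (\<Prod>i\<in>UNIV. prob (Z i -` {x i} \<inter> space M))"
      by (rule indep_varsD[OF ind]) auto
    also have "\<dots> = pmf (Pi_pmf UNIV 0 (\<lambda>_. p)) x" by (simp add: one pmf_Pi)
    finally show "emeasure (distr M (count_space UNIV) (\<lambda>\<omega> i. Z i \<omega>)) {x} =
        emeasure (measure_pmf (Pi_pmf UNIV 0 (\<lambda>_. p))) {x}"
      by (simp add: emeasure_pmf_single)
  qed (use c in auto)
qed

section \<open>Error estimates uniform in the length of the walk\<close>

lemma sum_lessThan_add:
  fixes t :: "nat \<Rightarrow> 'a::comm_monoid_add"
  shows "(\<Sum>s<L + m. t s) = (\<Sum>s<L. t s) + (\<Sum>s<m. t (L + s))"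
  by (induction m) (auto simp: add.assoc)

text \<open>A term before L is a vanishing probability compared with 1 / n; the later ones are
  summed geometrically. The bound is independent of m, which grows with n.\<close>

lemma sum_hit_deviation:
  fixes t :: "nat \<Rightarrow> real"
  assumes early: "\<And>s. s < L \<Longrightarrow> t s = 1 / real n" and nonneg: "\<And>s. 0 \<le> t s"
    and late: "\<And>s. t s \<le> C * \<rho> ^ Suc s" and "0 < C" "0 < \<rho>" "\<rho> < 1"
  shows "(\<Sum>s<m. t s) \<le> L / real n + C / (1 - \<rho>) * \<rho> ^ L"
proof -
  have "(\<Sum>s<m. t s) \<le> (\<Sum>s<L + m. t s)" by (rule sum_mono2) (use nonneg in auto)
  also have "\<dots> = L / real n + (\<Sum>s<m. t (L + s))" by (simp add: sum_lessThan_add early)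
  also have "(\<Sum>s<m. t (L + s)) \<le> (\<Sum>s<m. C * \<rho> ^ L * \<rho> ^ s)"
  proof (rule sum_mono)
    fix s
    have "C * \<rho> ^ Suc (L + s) \<le> C * \<rho> ^ (L + s)" using assms(4-6) by (simp add: mult_left_le_one_le)
    then show "t (L + s) \<le> C * \<rho> ^ L * \<rho> ^ s" using late[of "L + s"] by (simp add: power_add mult.assoc)
  qed
  also have "\<dots> = C * \<rho> ^ L * ((1 - \<rho> ^ m) / (1 - \<rho>))"
    using assms(6) by (simp only: sum_distrib_left[symmetric] sum_gp_strict) simp
  also have "\<dots> \<le> C * \<rho> ^ L * (1 / (1 - \<rho>))"
    using assms(4-6) by (intro mult_left_mono divide_right_mono) auto
  finally show ?thesis by simp
qed

lemma mpois_pmf: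
  fixes x :: "'r::finite \<Rightarrow> nat"
  assumes "0 < \<mu>"
  shows "mpois \<mu> (\<lambda>i. int (x i)) = pmf (Pi_pmf UNIV 0 (\<lambda>_. poisson_pmf \<mu>)) x"
  using assms by (simp add: mpois_def pois_def pmf_Pi mult_ac)

lemma one_plus_power_le_exp:
  fixes c h :: real
  assumes "0 \<le> c" "0 \<le> h" "real m * h \<le> \<mu>"
  shows "(1 + c * h) ^ m \<le> exp (c * \<mu>)"
proof -
  have "(1 + c * h) ^ m \<le> exp (c * h) ^ m"
    using assms exp_ge_add_one_self[of "c * h"] by (intro power_mono) auto
  also have "\<dots> = exp (c * (real m * h))" by (simp add: exp_of_nat_mult[symmetric] mult_ac)
  also have "\<dots> \<le> exp (c * \<mu>)" using assms by (simp add: mult_left_mono)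
  finally show ?thesis .
qed

lemma pmf_visits_eq:
  "pmf (map_pmf (\<lambda>ws i. visits m ws (v i)) (nb_walk G u m)) x =
    pmf (hit_law (nb_step G) (\<lambda>i. {ws. last ws = v i}) m [u]) (\<lambda>i. int (x i))"
proof -
  have "inj (\<lambda>y i. int (y i))" by (auto simp: inj_def fun_eq_iff)
  from pmf_map_inj'[OF this, of "map_pmf (\<lambda>ws i. visits m ws (v i)) (nb_walk G u m)" x]
  show ?thesis by (simp add: visits_nb_walk[symmetric] map_pmf_comp)
qed

theorem proposition1p2:
  fixes d :: nat and lam \<mu> :: real
    and N :: "nat set"
    and G :: "nat \<Rightarrow> 'v pair_pre_digraph"
    and g :: "nat \<Rightarrow> real"
    and v :: "nat \<Rightarrow> 'r::finite \<Rightarrow> 'v"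
    and i1 :: 'r
    and M :: "'w measure"
    and Z :: "'r \<Rightarrow> 'w \<Rightarrow> nat"
  assumes "d \<ge> 3" and "lam < real d" and "\<mu> > 0"
    and "infinite N" and "\<And>n. n \<in> N \<Longrightarrow> n > 0"
    and "\<And>n. n \<in> N \<Longrightarrow> ndl_graph n d lam (G n)"
    and "\<And>n. n \<in> N \<Longrightarrow> girth (G n) \<ge> ereal (g n)"
    and "filterlim g at_top (inf sequentially (principal N))"
    and "\<And>n i. n \<in> N \<Longrightarrow> v n i \<in> pverts (G n)"
    and "\<And>n i j. n \<in> N \<Longrightarrow> i \<noteq> j \<Longrightarrow> graph_dist (G n) (v n i) (v n j) \<ge> ereal (g n)"
    and "prob_space M"
    and "prob_space.indep_vars M (\<lambda>_. count_space UNIV) Z UNIV"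
    and "\<And>i. distr M (count_space UNIV) (Z i) = measure_pmf (poisson_pmf \<mu>)"
  shows "converges_in_distribution (inf sequentially (principal N))
           (\<lambda>n. measure_pmf (nb_walk (G n) (v n i1) (nat \<lfloor>\<mu> * real n\<rfloor>)))
           (\<lambda>n ws. \<chi> i. real (visits (nat \<lfloor>\<mu> * real n\<rfloor>) ws (v n i)))
           M (\<lambda>\<omega>. \<chi> i. real (Z i \<omega>))"
proof -
  let ?F = "inf sequentially (principal N)"
  let ?r = "real CARD('r)"
  define m where "m n = nat \<lfloor>\<mu> * real n\<rfloor>" for n
  define H where "H n i = {ws. last ws = v n i}" for n i
  define Q :: "('r \<Rightarrow> nat) pmf" where "Q = Pi_pmf UNIV 0 (\<lambda>_. poisson_pmf \<mu>)"
  have evN: "eventually (\<lambda>n. n \<in> N) ?F" by (simp add: eventually_inf_principal)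
  have le: "?F \<le> sequentially" by simp
  have real_n: "filterlim real at_top ?F"
    by (rule filterlim_mono[OF filterlim_real_sequentially order_refl le])
  have inv_n: "((\<lambda>n. c / real n) \<longlongrightarrow> 0) ?F" for c :: real
    by (rule tendsto_divide_0[OF tendsto_const filterlim_at_top_imp_at_infinity[OF real_n]])
  have m_le: "real (m n) \<le> \<mu> * real n" for n
    using assms(3) by (simp add: m_def)
  have m_ge: "\<mu> * real n - 1 \<le> real (m n)" for n
    using assms(3) by (simp add: m_def)
  have m_lim: "((\<lambda>n. real (m n) * (1 / real n)) \<longlongrightarrow> \<mu>) ?F"
  proof (rule tendsto_sandwich)
    show "eventually (\<lambda>n. \<mu> - 1 / real n \<le> real (m n) * (1 / real n)) ?F"
      using evN
    proof eventually_elim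
      case (elim n)
      have "\<mu> - 1 / real n = (\<mu> * real n - 1) / real n"
        using assms(5)[OF elim] by (simp add: diff_divide_distrib)
      also have "\<dots> \<le> real (m n) / real n" by (rule divide_right_mono[OF m_ge]) simp
      finally show ?case by simp
    qed
    show "eventually (\<lambda>n. real (m n) * (1 / real n) \<le> \<mu>) ?F"
      using evN
    proof eventually_elim
      case (elim n)
      then show ?case using m_le[of n] assms(5)[OF elim] by (simp add: field_simps)
    qed
    show "((\<lambda>n. \<mu> - 1 / real n) \<longlongrightarrow> \<mu>) ?F"
      using tendsto_diff[OF tendsto_const inv_n[of 1], of \<mu>] by simp
  qed simp
  obtain C \<rho> where C: "0 < C" "0 < \<rho>" "\<rho> < 1"
    and mixing: "\<And>n (G :: 'v pair_pre_digraph) ws v k. ndl_graph n d lam G \<Longrightarrow> nb_list G ws \<Longrightarrow> v \<in> pverts G \<Longrightarrow>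
      \<bar>measure_pmf.prob (kiter (nb_step G) k ws) {ws. last ws = v} - 1 / real n\<bar> \<le> C * \<rho> ^ k"
    using ndl_mixing[OF assms(1,2)] by metis
  have mix: "eventually (\<lambda>n. \<forall>ws i. nb_list (G n) ws \<longrightarrow> ws \<in> (\<Union>i. H n i) \<longrightarrow>
      (\<Sum>s<m n. \<bar>measure_pmf.prob (kiter (nb_step (G n)) (Suc s) ws) (H n i) - 1 / real n\<bar>) \<le> \<eta>) ?F"
    if "0 < \<eta>" for \<eta> :: real
  proof -
    \<comment> \<open>L is fixed by the tail alone; only then is n taken large enough for both L / n
      < \<eta> / 2 and L < g n.\<close>
    have "(\<lambda>L. C / (1 - \<rho>) * \<rho> ^ L) \<longlonglongrightarrow> C / (1 - \<rho>) * 0"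
      by (intro tendsto_intros LIMSEQ_power_zero) (use C in simp)
    then have "eventually (\<lambda>L. C / (1 - \<rho>) * \<rho> ^ L < \<eta> / 2) sequentially"
      by (rule order_tendstoD) (use that in simp)
    then obtain L where L: "C / (1 - \<rho>) * \<rho> ^ L < \<eta> / 2" by (auto simp: eventually_sequentially)
    have "eventually (\<lambda>n. L / real n < \<eta> / 2) ?F"
      by (rule order_tendstoD(2)[OF inv_n]) (use that in simp)
    moreover have "eventually (\<lambda>n. real L < g n) ?F"
      using assms(8) by (simp add: filterlim_at_top_dense)
    ultimately show ?thesis using evN
    proof eventually_elim
      case (elim n)
      note n = elim(3)
      interpret nb_regular "G n" d by (rule ndl_graph_nb_regular[OF assms(6)[OF n] assms(1)])
      show ?case
      proof (intro allI impI)
        fix ws i assume ws: "nb_list (G n) ws" "ws \<in> (\<Union>i. H n i)"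
        then obtain j where j: "last ws = v n j" by (auto simp: H_def)
        let ?t = "\<lambda>s. \<bar>measure_pmf.prob (kiter (nb_step (G n)) (Suc s) ws) (H n i) - 1 / real n\<bar>"
        have "(\<Sum>s<m n. ?t s) \<le> L / real n + C / (1 - \<rho>) * \<rho> ^ L"
        proof (rule sum_hit_deviation[OF _ _ _ C])
          fix s
          show "?t s \<le> C * \<rho> ^ Suc s"
            unfolding H_def by (rule mixing[OF assms(6)[OF n] ws(1) assms(9)[OF n]])
          assume s: "s < L"
          have "measure_pmf.prob (kiter (nb_step (G n)) (Suc s) ws) (H n i) = 0"
            unfolding H_def
          proof (rule no_early_hit[OF ws(1) _ _ assms(7)[OF n]])
            show "real (Suc s) < g n" using s elim(2) by linarith
            show "ereal (g n) \<le> graph_dist (G n) (last ws) (v n i)" if "v n i \<noteq> last ws"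
              using that j assms(10)[OF n, of j i] by (cases "i = j") auto
          qed simp
          then show "?t s = 1 / real n" by (simp del: kiter.simps)
        qed simp
        then show "(\<Sum>s<m n. ?t s) \<le> \<eta>" using L elim(1) by linarith
      qed
    qed
  qed
  have close: "((\<lambda>n. pmf (hit_law (nb_step (G n)) (H n) (m n) [v n i1]) x - mpois (real (m n) * (1 / real n)) x)
      \<longlongrightarrow> 0) ?F" for x :: "'r \<Rightarrow> int"
  proof (rule tendstoI)
    fix e :: real assume e: "0 < e"
    \<comment> \<open>E bounds the Gronwall factor for all n, and \<eta> is chosen to make
      \<open>(3 * ?r * \<eta> + \<eta>) * E\<close> equal to e / 2, the last \<eta> covering the
      discretisation error.\<close>
    define E where "E = exp (2 * ?r * \<mu>)"
    define \<eta> where "\<eta> = e / (2 * (3 * ?r + 1) * E)"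
    have pos: "0 < E" "0 < \<eta>" using e by (auto simp: E_def \<eta>_def intro!: divide_pos_pos mult_pos_pos add_nonneg_pos)
    have "eventually (\<lambda>n. 2 * ?r\<^sup>2 * \<mu> / real n < \<eta>) ?F"
      by (rule order_tendstoD(2)[OF inv_n pos(2)])
    \<comment> \<open>Positivity of g n forces the vertices \<open>v n i\<close> to be distinct,
      hence the sets \<open>H n i\<close> to be disjoint.\<close>
    moreover have "eventually (\<lambda>n. 0 < g n) ?F"
      using assms(8) by (simp add: filterlim_at_top_dense)
    ultimately show "eventually (\<lambda>n. dist (pmf (hit_law (nb_step (G n)) (H n) (m n) [v n i1]) x -
        mpois (real (m n) * (1 / real n)) x) 0 < e) ?F"
      using mix[OF pos(2)] evN
    proof eventually_elim
      case (elim n)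
      note n = elim(4)
      interpret nb_regular "G n" d by (rule ndl_graph_nb_regular[OF assms(6)[OF n] assms(1)])
      let ?h = "1 / real n"
      have h: "0 < ?h" using assms(5)[OF n] by simp
      have mh: "real (m n) * ?h \<le> \<mu>" using m_le[of n] assms(5)[OF n] by (simp add: field_simps)
      have single: "nb_list (G n) [v n i]" for i using assms(9)[OF n] by (simp add: nb_list_def)
      have "v n i \<noteq> v n j" if "i \<noteq> j" for i j
      proof
        assume eq: "v n i = v n j"
        have "graph_dist (G n) (v n i) (v n j) \<le> 0" using graph_dist_le[OF single, of 0 0 i] eq by (simp add: zero_ereal_def)
        with assms(10)[OF n that] have "ereal (g n) \<le> 0" by (rule order_trans)
        then show False using elim(2) by simp
      qed
      then have disj: "H n i \<inter> H n j = {}" if "i \<noteq> j" for i j using that by (auto simp: H_def)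
      have "\<bar>pmf (hit_law (nb_step (G n)) (H n) (m n) [v n i1]) x - mpois (real (m n) * ?h) x\<bar> \<le>
          (3 * ?r * \<eta> + real (m n) * (2 * ?r\<^sup>2 * ?h\<^sup>2)) * (1 + 2 * ?r * ?h) ^ m n"
        by (rule hit_law_poisson[where V = "Collect (nb_list (G n))" and ?m0.0 = "m n"])
          (use disj nb_step_closed h pos elim(3) single in \<open>auto simp: H_def\<close>)
      also have "\<dots> \<le> (3 * ?r * \<eta> + \<eta>) * E"
      proof (rule mult_mono)
        have "real (m n) * (2 * ?r\<^sup>2 * ?h\<^sup>2) = (real (m n) * ?h) * (2 * ?r\<^sup>2 * ?h)"
          by (simp add: power2_eq_square)
        also have "\<dots> \<le> \<mu> * (2 * ?r\<^sup>2 * ?h)" using mh by (intro mult_right_mono) auto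
        also have "\<dots> \<le> \<eta>" using elim(1) by (simp add: mult_ac)
        finally show "3 * ?r * \<eta> + real (m n) * (2 * ?r\<^sup>2 * ?h\<^sup>2) \<le> 3 * ?r * \<eta> + \<eta>" by simp
        show "(1 + 2 * ?r * ?h) ^ m n \<le> E"
          unfolding E_def by (rule one_plus_power_le_exp[OF _ _ mh]) auto
      qed (use pos in auto)
      also have "\<dots> = e / 2"
        using pos(1) unfolding \<eta>_def by (simp add: divide_simps add_nonneg_eq_0_iff) (simp add: algebra_simps)
      also have "\<dots> < e" using e by simp
      finally show ?case by (simp add: dist_real_def)
    qed
  qed
  have point: "((\<lambda>n. pmf (map_pmf (\<lambda>ws i. visits (m n) ws (v n i)) (nb_walk (G n) (v n i1) (m n))) x) \<longlongrightarrow> pmf Q x) ?F"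
    for x :: "'r \<Rightarrow> nat"
  proof -
    let ?x = "\<lambda>i. int (x i)"
    \<comment> \<open>The comparison was with mean m / n; continuity at \<mu> removes the effect of
      rounding \<mu> n down.\<close>
    have "isCont (\<lambda>t. mpois t ?x) \<mu>" by (rule DERIV_isCont[OF mpois_deriv])
    from tendsto_add[OF close[of ?x] isCont_tendsto_compose[OF this m_lim]]
    show ?thesis
      by (simp add: pmf_visits_eq H_def[abs_def] Q_def mpois_pmf[OF assms(3)])
  qed
  note Zv = distr_indep_poisson[OF assms(11-13), folded Q_def]
  show ?thesis
    unfolding converges_in_distribution_def m_def[symmetric]
  proof (intro allI impI)
    fix f :: "real ^ 'r \<Rightarrow> real"
    assume f: "continuous_on UNIV f \<and> bounded (range f)"
    then obtain B where B: "\<And>y. \<bar>f y\<bar> \<le> B" by (auto simp: bounded_iff)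
    have fm: "f \<in> borel_measurable borel" using f by (intro borel_measurable_continuous_onI) auto
    let ?c = "\<lambda>x :: 'r \<Rightarrow> nat. (\<chi> i. real (x i)) :: real ^ 'r"
    \<comment> \<open>On count vectors f is a bounded function on a countable set, so convergence of
      point probabilities is enough; its continuity supplies the measurability for the change of
      variables.\<close>
    have L: "integral\<^sup>L (distr (measure_pmf W) borel (\<lambda>ws. ?c (X ws))) f =
        measure_pmf.expectation (map_pmf X W) (\<lambda>x. f (?c x))" for W :: "'v list pmf" and X
      by (subst integral_distr[OF _ fm]) auto
    have Zr: "(\<lambda>\<omega>. ?c (\<lambda>i. Z i \<omega>)) \<in> measurable M borel"
      by (rule measurable_compose[OF Zv(1)]) simp
    have R: "integral\<^sup>L (distr M borel (\<lambda>\<omega>. ?c (\<lambda>i. Z i \<omega>))) f = measure_pmf.expectation Q (\<lambda>x. f (?c x))"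
      unfolding Zv(2)[symmetric]
      by (subst integral_distr[OF Zr fm], subst integral_distr[OF Zv(1)]) auto
    show "((\<lambda>n. integral\<^sup>L (distr (measure_pmf (nb_walk (G n) (v n i1) (m n))) borel
        (\<lambda>ws. \<chi> i. real (visits (m n) ws (v n i)))) f) \<longlongrightarrow>
      integral\<^sup>L (distr M borel (\<lambda>\<omega>. \<chi> i. real (Z i \<omega>))) f) ?F"
      using pmf_tendsto_expectation[OF point, of "\<lambda>x. f (?c x)" B] B
      unfolding R L[symmetric] by simp
  qed
qed

end
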